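(* Consider the group $$G=\big\langle a,t \;\big|\; t^2=1;\ [a,[a,a^t]]=[a^t,[a,a^t]]\ \text{commutes with } a \text{ and } a^t\big\rangle$$ with generating set $S=\{a,a^{-1},t\}$. Then its geodesic growth satisfies $$\gamma_{\mathrm{geod}}^{(G,S)}(n)\asymp\exp\!\big(n^{3/5}\cdot\log(n)\big).$$
   Context: Here $a^t=t^{-1}at=tat$ and $[x,y]=xyx^{-1}y^{-1}$ denotes the commutator. For $w\in S^*$, $\ell(w)$ is its length and $\overline w\in G$ its evaluation; $\|g\|_S=\min\{\ell(w):w\in S^*,\overline w=g\}$; $w$ is a geodesic if $\ell(w)=\|\overline w\|_S$. The geodesic growth function is $\gamma_{\mathrm{geod}}^{(G,S)}(n)=\#\{w\in S^*: w\text{ geodesic},\ \ell(w)\le n\}$. For functions $f,g$ on positive integers, $f\preceq g$ means there is $C>0$ with $f(n)\le Cg(Cn)+C$ for all $n\ge1$, and $f\asymp g$ means $f\preceq g$ and $g\preceq f$. *)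

theory Defs
  imports Complex_Main "HOL-Algebra.Group"
begin

text \<open>The letter \<open>(x, True)\<close> stands for the generator \<open>x\<close>, and
  \<open>(x, False)\<close> for its formal inverse.\<close>

type_synonym 'g word = "('g \<times> bool) list"

definition winv :: "'g word \<Rightarrow> 'g word" where
  "winv w = rev (map (\<lambda>(x, b). (x, \<not> b)) w)"

definition wcomm :: "'g word \<Rightarrow> 'g word \<Rightarrow> 'g word" where
  "wcomm u v = u @ v @ winv u @ winv v"

definition wconj :: "'g word \<Rightarrow> 'g word \<Rightarrow> 'g word" where
  "wconj u v = winv v @ u @ v"

text \<open>A pair \<open>(u, v)\<close> in \<open>R\<close> is the relation \<open>u = v\<close>.\<close>

inductive pres_eq :: "('g word \<times> 'g word) set \<Rightarrow> 'g word \<Rightarrow> 'g word \<Rightarrow> bool" for R where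
  pres_refl: "pres_eq R u u"
| pres_sym: "pres_eq R u v \<Longrightarrow> pres_eq R v u"
| pres_trans: "pres_eq R u v \<Longrightarrow> pres_eq R v w \<Longrightarrow> pres_eq R u w"
| pres_append: "pres_eq R u u' \<Longrightarrow> pres_eq R v v' \<Longrightarrow> pres_eq R (u @ v) (u' @ v')"
| pres_cancel: "pres_eq R [(x, b), (x, \<not> b)] []"
| pres_rel: "(u, v) \<in> R \<Longrightarrow> pres_eq R u v"

definition pres_class :: "('g word \<times> 'g word) set \<Rightarrow> 'g word \<Rightarrow> 'g word set" where
  "pres_class R w = {v. pres_eq R w v}"

definition presented_group :: "('g word \<times> 'g word) set \<Rightarrow> 'g word set monoid" where
  "presented_group R =
    \<lparr>carrier = range (pres_class R),
     mult = (\<lambda>X Y. \<Union>u\<in>X. \<Union>v\<in>Y. pres_class R (u @ v)),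
     one = pres_class R []\<rparr>"

lemma pres_class_eq_iff: "pres_class R u = pres_class R v \<longleftrightarrow> pres_eq R u v"
proof
  assume "pres_class R u = pres_class R v"
  then have "v \<in> pres_class R u" by (simp add: pres_class_def pres_refl)
  then show "pres_eq R u v" by (simp add: pres_class_def)
next
  assume "pres_eq R u v"
  then show "pres_class R u = pres_class R v"
    unfolding pres_class_def by (blast intro: pres_sym pres_trans)
qed

lemma presented_group_carrier: "carrier (presented_group R) = range (pres_class R)"
  by (simp add: presented_group_def)

lemma presented_group_one: "\<one>\<^bsub>presented_group R\<^esub> = pres_class R []"
  by (simp add: presented_group_def)

lemma presented_group_mult:
  "pres_class R u \<otimes>\<^bsub>presented_group R\<^esub> pres_class R v = pres_class R (u @ v)"
proof -
  have eq: "pres_class R (u' @ v') = pres_class R (u @ v)"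
    if "u' \<in> pres_class R u" "v' \<in> pres_class R v" for u' v'
  proof -
    have "pres_eq R u u'" "pres_eq R v v'" using that by (simp_all add: pres_class_def)
    then show ?thesis unfolding pres_class_eq_iff by (rule pres_sym[OF pres_append])
  qed
  have "u \<in> pres_class R u" "v \<in> pres_class R v"
    by (simp_all add: pres_class_def pres_refl)
  then have "(\<Union>u'\<in>pres_class R u. \<Union>v'\<in>pres_class R v. pres_class R (u' @ v')) =
      pres_class R (u @ v)"
    using eq by blast
  then show ?thesis by (simp add: presented_group_def)
qed

lemma pres_eq_winv_left: "pres_eq R (winv w @ w) []"
proof (induction w)
  case Nil
  then show ?case by (simp add: winv_def pres_refl)
next
  case (Cons p w)
  obtain x b where p: "p = (x, b)" by (cases p)
  have c: "pres_eq R [(x, \<not> b), (x, b)] []"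
    using pres_cancel[of R x "\<not> b"] by simp
  have "pres_eq R (winv w @ ([(x, \<not> b), (x, b)] @ w)) (winv w @ ([] @ w))"
    by (intro pres_append pres_refl c)
  then have "pres_eq R (winv (p # w) @ p # w) (winv w @ w)"
    by (simp add: winv_def p)
  then show ?case using Cons.IH by (rule pres_trans)
qed

lemma group_presented_group: "group (presented_group R)"
proof (rule groupI)
  fix X assume "X \<in> carrier (presented_group R)"
  then obtain w where "X = pres_class R w" by (auto simp: presented_group_carrier)
  then show "\<exists>Y\<in>carrier (presented_group R). Y \<otimes>\<^bsub>presented_group R\<^esub> X = \<one>\<^bsub>presented_group R\<^esub>"
    by (intro bexI[of _ "pres_class R (winv w)"])
      (auto simp: presented_group_carrier presented_group_mult presented_group_one
        pres_class_eq_iff pres_eq_winv_left)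
qed (auto simp: presented_group_carrier presented_group_mult presented_group_one)

lemma presented_group_inv:
  "inv\<^bsub>presented_group R\<^esub> (pres_class R w) = pres_class R (winv w)"
  by (rule group.inv_equality[OF group_presented_group])
    (auto simp: presented_group_carrier presented_group_mult presented_group_one
      pres_class_eq_iff pres_eq_winv_left)

definition word_subst :: "('b, 'c) monoid_scheme \<Rightarrow> ('g \<Rightarrow> 'b) \<Rightarrow> 'g word \<Rightarrow> 'b" where
  "word_subst H f w =
    foldr (\<lambda>(x, b) z. (if b then f x else inv\<^bsub>H\<^esub> (f x)) \<otimes>\<^bsub>H\<^esub> z) w \<one>\<^bsub>H\<^esub>"

lemma presented_group_universal:
  assumes H: "group H" and f: "\<And>x. f x \<in> carrier H"
    and R: "\<And>u v. (u, v) \<in> R \<Longrightarrow> word_subst H f u = word_subst H f v"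
  shows "\<exists>h\<in>hom (presented_group R) H. \<forall>w. h (pres_class R w) = word_subst H f w"
proof -
  interpret H: group H by (rule H)
  have closed: "word_subst H f w \<in> carrier H" for w
    by (induction w) (auto simp: word_subst_def f)
  have app: "word_subst H f (u @ v) = word_subst H f u \<otimes>\<^bsub>H\<^esub> word_subst H f v" for u v
  proof (induction u)
    case Nil
    then show ?case using closed[of v] by (simp add: word_subst_def)
  next
    case (Cons p u)
    have step: "word_subst H f (p # w) =
        (if snd p then f (fst p) else inv\<^bsub>H\<^esub> (f (fst p))) \<otimes>\<^bsub>H\<^esub> word_subst H f w" for w
      by (simp add: word_subst_def case_prod_beta)
    show ?case
      using Cons.IH closed f by (simp add: step H.m_assoc)
  qed
  have resp: "word_subst H f u = word_subst H f v" if "pres_eq R u v" for u v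
    using that
  proof induction
    case (pres_cancel x b)
    then show ?case by (cases b) (auto simp: word_subst_def f)
  qed (auto simp: app R)
  define h where "h X = word_subst H f (SOME w. w \<in> X)" for X
  have h: "h (pres_class R w) = word_subst H f w" for w
  proof -
    have "w \<in> pres_class R w" by (simp add: pres_class_def pres_refl)
    then have "(SOME v. v \<in> pres_class R w) \<in> pres_class R w" by (rule someI)
    then show ?thesis
      unfolding h_def using resp by (auto simp: pres_class_def)
  qed
  have "h \<in> hom (presented_group R) H"
    by (rule homI) (auto simp: presented_group_carrier presented_group_mult h closed app)
  with h show ?thesis by blast
qed

definition word_eval :: "('a, 'b) monoid_scheme \<Rightarrow> 'a list \<Rightarrow> 'a" where
  "word_eval G w = foldr (\<lambda>x y. x \<otimes>\<^bsub>G\<^esub> y) w \<one>\<^bsub>G\<^esub>"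

definition word_norm :: "('a, 'b) monoid_scheme \<Rightarrow> 'a set \<Rightarrow> 'a \<Rightarrow> nat" where
  "word_norm G S g = (LEAST n. \<exists>w\<in>lists S. word_eval G w = g \<and> length w = n)"

definition geodesic :: "('a, 'b) monoid_scheme \<Rightarrow> 'a set \<Rightarrow> 'a list \<Rightarrow> bool" where
  "geodesic G S w \<longleftrightarrow> w \<in> lists S \<and> length w = word_norm G S (word_eval G w)"

definition geodesic_growth :: "('a, 'b) monoid_scheme \<Rightarrow> 'a set \<Rightarrow> nat \<Rightarrow> nat" where
  "geodesic_growth G S n = card {w. geodesic G S w \<and> length w \<le> n}"

text \<open>The functions are compared on positive integers, so the constant \<open>C\<close>, which also
  rescales the argument, is a positive integer.\<close>

definition growth_le :: "(nat \<Rightarrow> real) \<Rightarrow> (nat \<Rightarrow> real) \<Rightarrow> bool" (infix "\<preceq>\<^sub>g" 50) where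
  "f \<preceq>\<^sub>g g \<longleftrightarrow> (\<exists>C::nat. C > 0 \<and> (\<forall>n\<ge>1. f n \<le> real C * g (C * n) + real C))"

definition growth_equiv :: "(nat \<Rightarrow> real) \<Rightarrow> (nat \<Rightarrow> real) \<Rightarrow> bool" (infix "\<asymp>\<^sub>g" 50) where
  "f \<asymp>\<^sub>g g \<longleftrightarrow> f \<preceq>\<^sub>g g \<and> g \<preceq>\<^sub>g f"

datatype gen = Gen_a | Gen_t

abbreviation wa :: "gen word" where "wa \<equiv> [(Gen_a, True)]"
abbreviation wt :: "gen word" where "wt \<equiv> [(Gen_t, True)]"
abbreviation wat :: "gen word" where "wat \<equiv> wconj wa wt"

definition rels :: "(gen word \<times> gen word) set" where
  "rels =
    (let c = wcomm wa (wcomm wa wat); c' = wcomm wat (wcomm wa wat)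
     in {(wt @ wt, []), (c, c'), (c @ wa, wa @ c), (c @ wat, wat @ c)})"

definition grp :: "gen word set monoid" where
  "grp = presented_group rels"

definition elt_a :: "gen word set" where
  "elt_a = pres_class rels wa"

definition elt_t :: "gen word set" where
  "elt_t = pres_class rels wt"

end

theory Submission
  imports Defs
begin

text \<open>Put \<open>t\<^sub>p = a\<^sup>p t a\<^sup>-\<^sup>p\<close>, so that a word reads \<open>t\<^sub>p\<^sub>1 \<dots> t\<^sub>p\<^sub>k a\<^sup>u\<close> and has length at least \<open>k\<close> plus the
  length of the tour \<open>0, p\<^sub>1, \<dots>, p\<^sub>k, u\<close>. The products \<open>t\<^sub>p t\<^sub>q\<close> generate a group \<open>\<int>\<^sup>3\<close> on which \<open>a\<close> acts
  unipotently, and the element represented by a word is determined exactly by \<open>u\<close> and the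
  alternating power sums \<open>p\<^sub>1\<^sup>j - p\<^sub>2\<^sup>j + p\<^sub>3\<^sup>j - \<dots>\<close> for \<open>j \<le> 3\<close>.

  Lower bound: let \<open>p\<^sub>1, -p\<^sub>2, p\<^sub>3, \<dots>\<close> be \<open>k = 2 i\<^sup>6\<close> numbers between \<open>4 i\<^sup>4\<close> and \<open>4 i\<^sup>4 + i\<close>. By
  convexity, a word with the same first power sum and fewer turns has a larger third power sum;
  correcting this with steps in the wrong direction costs more than the turns that were saved. So
  these \<open>(i + 1)\<^sup>k\<close> words, of length \<open>O(i\<^sup>1\<^sup>0)\<close>, are all geodesic.

  Upper bound: modulo the centre the group is virtually a Heisenberg group, in which every lattice
  path can be replaced by one that is not longer and has a bounded number of corners. In a word of
  length \<open>n\<close> with \<open>k\<close> letters \<open>t\<close>, doing this on the short ones among \<open>\<Theta>(k)\<close> consecutive blocks saves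
  \<open>\<Theta>(k)\<close> letters and changes the central coordinate by \<open>O(n\<^sup>3 / k\<^sup>2)\<close>, which is repaired by a word of
  length \<open>O(n / k\<^sup>2\<^sup>/\<^sup>3)\<close>. Hence \<open>k = O(n\<^sup>3\<^sup>/\<^sup>5)\<close> in a geodesic, and a geodesic is determined by its \<open>k + 1\<close>
  powers of \<open>a\<close>.\<close>

section \<open>Normal forms\<close>

text \<open>The relations of the presentation in an arbitrary group, with \<open>b\<close> = a^t,
  \<open>c\<close> = [a, b] and \<open>z\<close> = [a, c]. Since \<open>d\<close> = t (a t a^-1), it
  is a product of two neighbouring conjugates of \<open>t\<close>; \<open>d\<close>,
  \<open>c\<close> and \<open>z\<close> commute with each other and span the kernel part of the
  normal form.\<close>

locale engel_extension = group G for G (structure) +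
  fixes a t b c z d
  assumes a [simp]: "a \<in> carrier G" and t [simp]: "t \<in> carrier G"
    and tt: "t \<otimes> t = \<one>"
    and b_def: "b = t \<otimes> a \<otimes> t"
    and c_def: "c = a \<otimes> b \<otimes> inv a \<otimes> inv b"
    and z_def: "z = a \<otimes> c \<otimes> inv a \<otimes> inv c"
    and d_def: "d = b \<otimes> inv a"
    and bc: "b \<otimes> c \<otimes> inv b \<otimes> inv c = z"
    and za: "z \<otimes> a = a \<otimes> z" and zb: "z \<otimes> b = b \<otimes> z"
begin

lemma closed [simp]: "b \<in> carrier G" "c \<in> carrier G" "z \<in> carrier G" "d \<in> carrier G"
  by (simp_all add: b_def c_def z_def d_def)

lemma inv_cancel [simp]:
  "x \<in> carrier G \<Longrightarrow> y \<in> carrier G \<Longrightarrow> inv x \<otimes> (x \<otimes> y) = y"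
  "x \<in> carrier G \<Longrightarrow> y \<in> carrier G \<Longrightarrow> x \<otimes> (inv x \<otimes> y) = y"
  by (simp_all flip: m_assoc)

lemma tt_cancel [simp]: "x \<in> carrier G \<Longrightarrow> t \<otimes> (t \<otimes> x) = x"
  using tt by (simp flip: m_assoc)

lemma commute_inv:
  assumes "x \<in> carrier G" "y \<in> carrier G" "x \<otimes> y = y \<otimes> x"
  shows "x \<otimes> inv y = inv y \<otimes> x"
proof -
  have "x \<otimes> inv y = inv y \<otimes> (y \<otimes> x) \<otimes> inv y" using assms(1,2) by (simp add: m_assoc)
  also have "\<dots> = inv y \<otimes> x" unfolding assms(3)[symmetric] using assms(1,2) by (simp add: m_assoc)
  finally show ?thesis .
qed

lemma commute_mult:
  assumes "x \<in> carrier G" "y \<in> carrier G" "y' \<in> carrier G" "x \<otimes> y = y \<otimes> x" "x \<otimes> y' = y' \<otimes> x"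
  shows "x \<otimes> (y \<otimes> y') = (y \<otimes> y') \<otimes> x"
  using assms by (metis m_assoc)

lemma tbt: "t \<otimes> b = a \<otimes> t"
  by (simp add: b_def m_assoc)

lemma a_t: "a \<otimes> t = t \<otimes> d \<otimes> a"
  by (simp add: d_def m_assoc tbt)

lemma a_d: "a \<otimes> d = c \<otimes> d \<otimes> a"
  by (simp add: d_def c_def m_assoc)

lemma a_c: "a \<otimes> c = z \<otimes> c \<otimes> a"
  by (simp add: z_def m_assoc)

lemma b_c: "b \<otimes> c = z \<otimes> c \<otimes> b"
  by (simp add: m_assoc flip: bc)

lemma zc: "z \<otimes> c = c \<otimes> z"
  unfolding c_def by (intro commute_mult commute_inv za zb) simp_all

lemma zd: "z \<otimes> d = d \<otimes> z"
  unfolding d_def by (intro commute_mult commute_inv za zb) simp_all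

text \<open>Conjugation by \<open>a\<close> and conjugation by \<open>b\<close> both send
  \<open>c\<close> to \<open>z \<otimes> c\<close>, so \<open>d = b \<otimes> inv a\<close>
  centralises \<open>c\<close>.\<close>

lemma cd: "c \<otimes> d = d \<otimes> c"
proof -
  have "d \<otimes> c = d \<otimes> (c \<otimes> a) \<otimes> inv a" by (simp add: m_assoc)
  also have "c \<otimes> a = inv z \<otimes> (a \<otimes> c)" by (simp add: a_c m_assoc)
  also have "d \<otimes> (inv z \<otimes> (a \<otimes> c)) = inv z \<otimes> (d \<otimes> (a \<otimes> c))"
    using commute_inv[of d z] zd by (simp flip: m_assoc)
  also have "d \<otimes> (a \<otimes> c) = b \<otimes> c" by (simp add: d_def m_assoc)
  also have "inv z \<otimes> (b \<otimes> c) \<otimes> inv a = c \<otimes> d"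
    by (simp add: b_c m_assoc) (simp add: d_def)
  finally show ?thesis by simp
qed

lemma conj_pow:
  assumes "x \<in> carrier G" "y \<in> carrier G" "y' \<in> carrier G" "x \<otimes> y = y' \<otimes> x"
  shows "x \<otimes> y [^] (n::int) = y' [^] n \<otimes> x"
proof -
  have nat: "x \<otimes> y [^] k = y' [^] k \<otimes> x" for k :: nat
  proof (induction k)
    case (Suc k)
    have "x \<otimes> y [^] Suc k = y' [^] k \<otimes> (x \<otimes> y)"
      using assms(1-3) Suc by (simp flip: m_assoc)
    also have "\<dots> = y' [^] Suc k \<otimes> x"
      unfolding assms(4) using assms(1-3) by (simp add: m_assoc)
    finally show ?case .
  qed (use assms in simp)
  have "x \<otimes> inv (y [^] k) = inv (y' [^] k) \<otimes> x" for k :: nat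
  proof -
    have "y' [^] k \<otimes> (x \<otimes> inv (y [^] k)) = x"
      using assms(1-3) by (simp add: nat[of k, symmetric] flip: m_assoc) (simp add: m_assoc)
    then show ?thesis using assms inv_cancel(1)[of "y' [^] k" "x \<otimes> inv (y [^] k)"] by simp
  qed
  with nat show ?thesis using assms by (cases n rule: int_cases2) (simp_all add: int_pow_int int_pow_neg)
qed

text \<open>The order of the factors is chosen so that left multiplication by a generator only
  updates exponents; words can then be evaluated letter by letter from the right.\<close>

definition nf :: "bool \<Rightarrow> int \<Rightarrow> int \<Rightarrow> int \<Rightarrow> int \<Rightarrow> 'a" where
  "nf e u \<alpha> \<beta> \<gamma> = (if e then t else \<one>) \<otimes> (d [^] \<alpha> \<otimes> (c [^] \<beta> \<otimes> (z [^] \<gamma> \<otimes> a [^] u)))"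

lemma nf_closed [simp]: "nf e u \<alpha> \<beta> \<gamma> \<in> carrier G"
  by (simp add: nf_def)

lemma t_nf: "t \<otimes> nf e u \<alpha> \<beta> \<gamma> = nf (\<not> e) u \<alpha> \<beta> \<gamma>"
  by (simp add: nf_def)

text \<open>Unipotent action: conjugation by \<open>a\<close> sends \<open>d\<close> to
  \<open>c \<otimes> d\<close> and \<open>c\<close> to \<open>z \<otimes> c\<close>, and fixes
  \<open>z\<close>.\<close>

lemma a_kernel:
  "a \<otimes> (d [^] \<alpha> \<otimes> (c [^] \<beta> \<otimes> (z [^] \<gamma> \<otimes> a [^] u)))
    = d [^] \<alpha> \<otimes> (c [^] (\<beta> + \<alpha>) \<otimes> (z [^] (\<gamma> + \<beta>) \<otimes> a [^] (u + 1)))" for u \<alpha> \<beta> \<gamma> :: int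
proof -
  have D: "a \<otimes> (d [^] \<alpha> \<otimes> x) = d [^] \<alpha> \<otimes> (c [^] \<alpha> \<otimes> (a \<otimes> x))" if "x \<in> carrier G" for x
  proof -
    have "a \<otimes> d [^] \<alpha> = (c \<otimes> d) [^] \<alpha> \<otimes> a" by (rule conj_pow) (simp_all add: a_d)
    also have "(c \<otimes> d) [^] \<alpha> = d [^] \<alpha> \<otimes> c [^] \<alpha>"
      by (simp add: cd int_pow_mult_distrib)
    finally show ?thesis using that by (simp flip: m_assoc)
  qed
  have C: "a \<otimes> (c [^] \<beta> \<otimes> x) = c [^] \<beta> \<otimes> (z [^] \<beta> \<otimes> (a \<otimes> x))" if "x \<in> carrier G" for x
  proof -
    have "a \<otimes> c [^] \<beta> = (z \<otimes> c) [^] \<beta> \<otimes> a" by (rule conj_pow) (simp_all add: a_c)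
    also have "(z \<otimes> c) [^] \<beta> = c [^] \<beta> \<otimes> z [^] \<beta>"
      by (simp add: zc int_pow_mult_distrib)
    finally show ?thesis using that by (simp flip: m_assoc)
  qed
  have Z: "a \<otimes> (z [^] \<gamma> \<otimes> x) = z [^] \<gamma> \<otimes> (a \<otimes> x)" if "x \<in> carrier G" for x
    using conj_pow[of a z z \<gamma>] za that by (simp flip: m_assoc)
  have A: "a \<otimes> a [^] u = a [^] (u + 1)"
    by (metis a add.commute int_pow_1 int_pow_mult)
  have "a \<otimes> (d [^] \<alpha> \<otimes> (c [^] \<beta> \<otimes> (z [^] \<gamma> \<otimes> a [^] u)))
    = d [^] \<alpha> \<otimes> ((c [^] \<alpha> \<otimes> c [^] \<beta>) \<otimes> ((z [^] \<beta> \<otimes> z [^] \<gamma>) \<otimes> a [^] (u + 1)))"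
    by (simp add: D C Z A m_assoc)
  then show ?thesis by (simp add: int_pow_mult add.commute)
qed

lemma a_nf: "a \<otimes> nf e u \<alpha> \<beta> \<gamma> = nf e (u + 1) (\<alpha> + (if e then 1 else 0)) (\<beta> + \<alpha>) (\<gamma> + \<beta>)"
proof (cases e)
  case True
  have "a \<otimes> nf e u \<alpha> \<beta> \<gamma> = t \<otimes> (d \<otimes> (a \<otimes> (d [^] \<alpha> \<otimes> (c [^] \<beta> \<otimes> (z [^] \<gamma> \<otimes> a [^] u)))))"
    using True by (simp add: nf_def a_t flip: m_assoc)
  also have "\<dots> = t \<otimes> ((d \<otimes> d [^] \<alpha>) \<otimes> (c [^] (\<beta> + \<alpha>) \<otimes> (z [^] (\<gamma> + \<beta>) \<otimes> a [^] (u + 1))))"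
    by (simp only: a_kernel) (simp add: m_assoc)
  also have "d \<otimes> d [^] \<alpha> = d [^] (\<alpha> + 1)"
    by (metis closed(4) add.commute int_pow_1 int_pow_mult)
  finally show ?thesis using True by (simp add: nf_def)
qed (simp add: nf_def a_kernel)

lemma inv_a_nf:
  "inv a \<otimes> nf e u \<alpha> \<beta> \<gamma>
    = nf e (u - 1) (\<alpha> - (if e then 1 else 0)) (\<beta> - (\<alpha> - (if e then 1 else 0)))
        (\<gamma> - (\<beta> - (\<alpha> - (if e then 1 else 0))))"
proof -
  have "nf e u \<alpha> \<beta> \<gamma> = a \<otimes> nf e (u - 1) (\<alpha> - (if e then 1 else 0))
     (\<beta> - (\<alpha> - (if e then 1 else 0))) (\<gamma> - (\<beta> - (\<alpha> - (if e then 1 else 0))))"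
    by (simp add: a_nf)
  then show ?thesis by simp
qed

end

section \<open>Alternating power sums\<close>

fun disp :: "gen word \<Rightarrow> int" where
  "disp [] = 0"
| "disp ((Gen_a, b) # w) = (if b then 1 else -1) + disp w"
| "disp ((Gen_t, b) # w) = disp w"

fun tpos :: "int \<Rightarrow> gen word \<Rightarrow> int list" where
  "tpos u [] = []"
| "tpos u ((Gen_a, b) # w) = tpos (u + (if b then 1 else -1)) w"
| "tpos u ((Gen_t, b) # w) = u # tpos u w"

text \<open>As 0 ^ 0 = 1, the case of exponent 0 is the parity of the number of positions, so the
  parity of the number of letters \<open>t\<close> is treated as one more power sum.\<close>

fun alt :: "nat \<Rightarrow> int list \<Rightarrow> int" where
  "alt j [] = 0"
| "alt j (p # ps) = p ^ j - alt j ps"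

abbreviation tcount :: "gen word \<Rightarrow> nat" where
  "tcount w \<equiv> length (filter (\<lambda>l. fst l = Gen_t) w)"

abbreviation psum :: "nat \<Rightarrow> gen word \<Rightarrow> int" where
  "psum j w \<equiv> alt j (tpos 0 w)"

text \<open>With \<open>n = 3\<close> this turns out to be equality in the group, with
  \<open>n = 2\<close> equality modulo the powers of [a, [a, a^t]].\<close>

definition same_moments :: "nat \<Rightarrow> gen word \<Rightarrow> gen word \<Rightarrow> bool" where
  "same_moments n w w' \<longleftrightarrow> disp w = disp w' \<and> (\<forall>j\<le>n. psum j w = psum j w')"

lemma disp_append [simp]: "disp (v @ w) = disp v + disp w"
  by (induction v rule: disp.induct) simp_all

lemma tpos_append [simp]: "tpos u (v @ w) = tpos u v @ tpos (u + disp v) w"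
  by (induction u v rule: tpos.induct) (simp_all add: algebra_simps)

lemma length_tpos [simp]: "length (tpos u w) = tcount w"
  by (induction u w rule: tpos.induct) simp_all

lemma tpos_shift: "tpos (u + v) w = map ((+) u) (tpos v w)"
proof (induction v w rule: tpos.induct)
  case (2 v b w)
  then show ?case by (simp add: algebra_simps)
qed simp_all

lemma tpos_shift0: "tpos u w = map ((+) u) (tpos 0 w)"
  using tpos_shift[of u 0] by simp

lemma alt_append: "alt j (ps @ qs) = alt j ps + (-1) ^ length ps * alt j qs"
  by (induction ps) simp_all

lemma alt_0: "alt 0 ps = (if even (length ps) then 0 else 1)"
  by (induction ps) simp_all

lemma alt_shift:
  "alt 0 (map ((+) u) ps) = alt 0 ps"
  "alt 1 (map ((+) u) ps) = alt 1 ps + u * alt 0 ps"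
  "alt 2 (map ((+) u) ps) = alt 2 ps + 2 * u * alt 1 ps + u\<^sup>2 * alt 0 ps"
  "alt 3 (map ((+) u) ps) = alt 3 ps + 3 * u * alt 2 ps + 3 * u\<^sup>2 * alt 1 ps + u ^ 3 * alt 0 ps"
  by (induction ps) (simp_all add: algebra_simps power2_eq_square power3_eq_cube)

lemma psum_append:
  fixes u :: "gen word"
  defines "s \<equiv> (-1) ^ tcount u"
  shows "psum 0 (u @ v) = psum 0 u + s * psum 0 v"
    "psum 1 (u @ v) = psum 1 u + s * (psum 1 v + disp u * psum 0 v)"
    "psum 2 (u @ v) = psum 2 u + s * (psum 2 v + 2 * disp u * psum 1 v + (disp u)\<^sup>2 * psum 0 v)"
    "psum 3 (u @ v) = psum 3 u + s * (psum 3 v + 3 * disp u * psum 2 v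
        + 3 * (disp u)\<^sup>2 * psum 1 v + disp u ^ 3 * psum 0 v)"
  by (simp_all only: tpos_append alt_append length_tpos add_0 s_def tpos_shift0[of "disp u" v] alt_shift)

lemma le_2_3: "(\<forall>j\<le>2. P j) \<longleftrightarrow> P 0 \<and> P 1 \<and> P 2" "(\<forall>j\<le>3. P j) \<longleftrightarrow> P 0 \<and> P 1 \<and> P 2 \<and> P 3"
  for P :: "nat \<Rightarrow> bool"
  by (auto simp: numeral_2_eq_2 numeral_3_eq_3 le_Suc_eq)

lemma same_moments_2:
  "same_moments 2 w w' \<longleftrightarrow> disp w = disp w' \<and> psum 0 w = psum 0 w' \<and> psum 1 w = psum 1 w' \<and> psum 2 w = psum 2 w'"
  by (auto simp: same_moments_def le_2_3)

lemma same_moments_3: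
  "same_moments 3 w w' \<longleftrightarrow> same_moments 2 w w' \<and> psum 3 w = psum 3 w'"
  by (auto simp: same_moments_def le_2_3)

lemma minus_one_tcount: "(-1) ^ tcount w = 1 - 2 * psum 0 w"
  by (simp add: alt_0)

lemma same_moments_append:
  assumes "same_moments 2 u u'" "same_moments 2 v v'"
  shows "same_moments 2 (u @ v) (u' @ v')"
  using assms unfolding same_moments_2 psum_append minus_one_tcount disp_append by simp

lemma same_moments_append3:
  assumes "same_moments 3 u u'" "same_moments 3 v v'"
  shows "same_moments 3 (u @ v) (u' @ v')"
  using assms unfolding same_moments_3 same_moments_2 psum_append minus_one_tcount disp_append by simp

text \<open>Multiplication by \<open>a\<close> on the left shifts all positions by one, whence the binomial coefficients.\<close>

type_synonym mom = "int \<times> int \<times> int \<times> int \<times> int"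

fun letter_act :: "gen \<times> bool \<Rightarrow> mom \<Rightarrow> mom" where
  "letter_act (Gen_t, b) (u, p0, p1, p2, p3) = (u, 1 - p0, - p1, - p2, - p3)"
| "letter_act (Gen_a, True) (u, p0, p1, p2, p3)
    = (u + 1, p0, p1 + p0, p2 + 2 * p1 + p0, p3 + 3 * p2 + 3 * p1 + p0)"
| "letter_act (Gen_a, False) (u, p0, p1, p2, p3)
    = (u - 1, p0, p1 - p0, p2 - 2 * p1 + p0, p3 - 3 * p2 + 3 * p1 - p0)"

text \<open>The letters act on all of \<int>^5, and each relation is checked on a general tuple.
  Equality of the maps, not merely of their values at 0, is what passes through
  concatenation.\<close>

lemma letter_act_pres_eq: "pres_eq rels v w \<Longrightarrow> foldr letter_act v = foldr letter_act w"
proof (induction rule: pres_eq.induct)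
  case (pres_cancel x b)
  show ?case by (cases x; cases b) (auto simp: fun_eq_iff)
next
  case (pres_rel u v)
  then show ?case
    by (auto simp: rels_def Let_def wcomm_def wconj_def winv_def fun_eq_iff)
qed simp_all

lemma tpos_pm1:
  "tpos (-1) w = map ((+) (-1)) (tpos 0 w)" "tpos 1 w = map ((+) 1) (tpos 0 w)"
  by (rule tpos_shift0)+

lemma foldr_letter_act:
  "foldr letter_act w (0, 0, 0, 0, 0) = (disp w, psum 0 w, psum 1 w, psum 2 w, psum 3 w)"
proof (induction w)
  case (Cons l w)
  then show ?case
    by (cases "(l, (0,0,0,0,0)::mom)" rule: letter_act.cases)
      (simp_all add: tpos_pm1 alt_shift[unfolded One_nat_def] power2_eq_square power3_eq_cube)
qed simp

lemma pres_eq_imp_same_moments: "pres_eq rels v w \<Longrightarrow> same_moments 3 v w"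
  using letter_act_pres_eq[of v w] foldr_letter_act[of v] foldr_letter_act[of w]
  unfolding same_moments_3 same_moments_2 by simp

section \<open>Normal forms in the presented group\<close>

lemma grp_group: "group grp"
  unfolding grp_def by (rule group_presented_group)

lemma grp_mult: "pres_class rels u \<otimes>\<^bsub>grp\<^esub> pres_class rels v = pres_class rels (u @ v)"
  unfolding grp_def by (rule presented_group_mult)

lemma grp_inv: "inv\<^bsub>grp\<^esub> pres_class rels u = pres_class rels (winv u)"
  unfolding grp_def by (rule presented_group_inv)

lemma grp_one: "\<one>\<^bsub>grp\<^esub> = pres_class rels []"
  unfolding grp_def by (rule presented_group_one)

lemma grp_rel: "(u, v) \<in> rels \<Longrightarrow> pres_class rels u = pres_class rels v"
  by (simp add: pres_class_eq_iff pres_eq.pres_rel)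

lemma class_t_False: "pres_class rels [(Gen_t, False)] = elt_t"
proof -
  interpret group grp by (rule grp_group)
  have [simp]: "elt_t \<in> carrier grp" by (simp add: elt_t_def grp_def presented_group_carrier)
  have "elt_t \<otimes>\<^bsub>grp\<^esub> elt_t = \<one>\<^bsub>grp\<^esub>"
    unfolding elt_t_def grp_mult grp_one by (rule grp_rel) (simp add: rels_def Let_def)
  then have "inv\<^bsub>grp\<^esub> elt_t = elt_t" by (simp add: inv_equality)
  then show ?thesis by (simp add: elt_t_def grp_inv winv_def)
qed


lemma grp_engel_extension:
  "engel_extension grp elt_a elt_t (pres_class rels wat) (pres_class rels (wcomm wa wat))
    (pres_class rels (wcomm wa (wcomm wa wat))) (pres_class rels (wat @ winv wa))"
proof -
  interpret group grp by (rule grp_group)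
  have comm: "pres_class rels (wcomm u v) = pres_class rels u \<otimes>\<^bsub>grp\<^esub> pres_class rels v
      \<otimes>\<^bsub>grp\<^esub> inv\<^bsub>grp\<^esub> pres_class rels u \<otimes>\<^bsub>grp\<^esub> inv\<^bsub>grp\<^esub> pres_class rels v" for u v
    by (simp add: wcomm_def grp_mult grp_inv)
  have za: "pres_class rels (wcomm wa (wcomm wa wat) @ wa) = pres_class rels (wa @ wcomm wa (wcomm wa wat))"
    by (rule grp_rel) (simp add: rels_def Let_def)
  have zb: "pres_class rels (wcomm wa (wcomm wa wat) @ wat) = pres_class rels (wat @ wcomm wa (wcomm wa wat))"
    by (rule grp_rel) (simp add: rels_def Let_def)
  have rel: "pres_class rels (wcomm wat (wcomm wa wat)) = pres_class rels (wcomm wa (wcomm wa wat))"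
    by (rule sym, rule grp_rel) (simp add: rels_def Let_def)
  show ?thesis
  proof
    show "elt_a \<in> carrier grp" "elt_t \<in> carrier grp"
      by (simp_all add: elt_a_def elt_t_def grp_def presented_group_carrier)
    show "elt_t \<otimes>\<^bsub>grp\<^esub> elt_t = \<one>\<^bsub>grp\<^esub>"
      unfolding elt_t_def grp_mult grp_one by (rule grp_rel) (simp add: rels_def Let_def)
    have "pres_class rels wat = pres_class rels (winv wt) \<otimes>\<^bsub>grp\<^esub> elt_a \<otimes>\<^bsub>grp\<^esub> elt_t"
      unfolding elt_a_def elt_t_def grp_mult by (simp add: wconj_def)
    then show "pres_class rels wat = elt_t \<otimes>\<^bsub>grp\<^esub> elt_a \<otimes>\<^bsub>grp\<^esub> elt_t"
      using class_t_False by (simp add: winv_def)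
  qed ((simp_all only: elt_a_def comm[symmetric] rel)?, (simp_all only: grp_mult grp_inv za zb)?)
qed

interpretation G: engel_extension grp elt_a elt_t
  "pres_class rels wat" "pres_class rels (wcomm wa wat)"
  "pres_class rels (wcomm wa (wcomm wa wat))" "pres_class rels (wat @ winv wa)"
  by (rule grp_engel_extension)

lemma class_letter:
  "pres_class rels [(x, b)] = (case x of Gen_a \<Rightarrow> if b then elt_a else inv\<^bsub>grp\<^esub> elt_a | Gen_t \<Rightarrow> elt_t)"
proof (cases x)
  case Gen_a
  then show ?thesis by (simp add: elt_a_def grp_inv winv_def)
next
  case Gen_t
  then show ?thesis using class_t_False by (cases b) (simp_all add: elt_t_def)
qed

text \<open>Up to the sign \<open>2 * psum 0 w - 1\<close>, the exponents are the alternating sums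
  of p, binom(p, 2) and binom(p, 3) over the positions p. A letter \<open>a\<close> on the left
  shifts every p by one, and Pascal's rule matches the update of the exponents.\<close>

lemma class_nf:
  obtains \<alpha> \<beta> \<gamma> where "pres_class rels w = G.nf (odd (tcount w)) (disp w) \<alpha> \<beta> \<gamma>"
    "psum 1 w = (2 * psum 0 w - 1) * \<alpha>"
    "psum 2 w = psum 1 w + 2 * (2 * psum 0 w - 1) * \<beta>"
    "psum 3 w = 3 * psum 2 w - 2 * psum 1 w + 6 * (2 * psum 0 w - 1) * \<gamma>"
proof -
  have "\<exists>\<alpha> \<beta> \<gamma>. pres_class rels w = G.nf (odd (tcount w)) (disp w) \<alpha> \<beta> \<gamma> \<and>
    psum 1 w = (2 * psum 0 w - 1) * \<alpha> \<and>
    psum 2 w = psum 1 w + 2 * (2 * psum 0 w - 1) * \<beta> \<and>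
    psum 3 w = 3 * psum 2 w - 2 * psum 1 w + 6 * (2 * psum 0 w - 1) * \<gamma>"
  proof (induction w)
    case Nil
    show ?case by (intro exI[of _ 0]) (simp add: G.nf_def flip: grp_one)
  next
    case (Cons l w)
    then obtain \<alpha> \<beta> \<gamma> where IH: "pres_class rels w = G.nf (odd (tcount w)) (disp w) \<alpha> \<beta> \<gamma>"
      "psum 1 w = (2 * psum 0 w - 1) * \<alpha>"
      "psum 2 w = psum 1 w + 2 * (2 * psum 0 w - 1) * \<beta>"
      "psum 3 w = 3 * psum 2 w - 2 * psum 1 w + 6 * (2 * psum 0 w - 1) * \<gamma>" by blast
    have cl: "pres_class rels (l # w) = pres_class rels [l] \<otimes>\<^bsub>grp\<^esub> pres_class rels w"
      by (simp add: grp_mult)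
    define e where "e = (if odd (tcount w) then 1 else 0 :: int)"
    have e: "psum 0 w = e" by (simp add: alt_0 e_def)
    obtain x b where l: "l = (x, b)" by (cases l)
    consider "x = Gen_t" | "x = Gen_a" "b" | "x = Gen_a" "\<not> b" by (cases x) auto
    then show ?case
    proof cases
      case 1
      have C: "pres_class rels (l # w) = elt_t \<otimes>\<^bsub>grp\<^esub> pres_class rels w"
        using cl class_letter[of x b] l 1 by simp
      have D: "disp (l # w) = disp w" "odd (tcount (l # w)) = (\<not> odd (tcount w))" by (simp_all add: l 1)
      have S: "psum 0 (l # w) = 1 - psum 0 w" "psum 1 (l # w) = - psum 1 w" "psum 2 (l # w) = - psum 2 w"
        "psum 3 (l # w) = - psum 3 w" by (simp_all add: l 1)
      show ?thesis
        by (rule exI[of _ \<alpha>], rule exI[of _ \<beta>], rule exI[of _ \<gamma>])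
          (simp only: C D S IH(1) G.t_nf IH(2-4), simp add: algebra_simps)
    next
      case 2
      have C: "pres_class rels (l # w) = elt_a \<otimes>\<^bsub>grp\<^esub> pres_class rels w"
        using cl class_letter[of x b] l 2 by simp
      have D: "disp (l # w) = disp w + 1" "odd (tcount (l # w)) = odd (tcount w)" by (simp_all add: l 2)
      have S: "psum 0 (l # w) = psum 0 w" "psum 1 (l # w) = psum 1 w + e" "psum 2 (l # w) = psum 2 w + 2 * psum 1 w + e"
        "psum 3 (l # w) = psum 3 w + 3 * psum 2 w + 3 * psum 1 w + e"
        using alt_shift[of 1 "tpos 0 w"] by (simp_all add: l 2 tpos_pm1 e)
      show ?thesis
        by (rule exI[of _ "\<alpha> + e"], rule exI[of _ "\<beta> + \<alpha>"], rule exI[of _ "\<gamma> + \<beta>"])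
          (simp only: C D S IH(1) G.a_nf IH(2-4) e, simp add: e_def algebra_simps)
    next
      case 3
      have C: "pres_class rels (l # w) = inv\<^bsub>grp\<^esub> elt_a \<otimes>\<^bsub>grp\<^esub> pres_class rels w"
        using cl class_letter[of x b] l 3 by simp
      have D: "disp (l # w) = disp w - 1" "odd (tcount (l # w)) = odd (tcount w)" by (simp_all add: l 3)
      have S: "psum 0 (l # w) = psum 0 w" "psum 1 (l # w) = psum 1 w - e" "psum 2 (l # w) = psum 2 w - 2 * psum 1 w + e"
        "psum 3 (l # w) = psum 3 w - 3 * psum 2 w + 3 * psum 1 w - e"
        using alt_shift[of "-1" "tpos 0 w"] by (simp_all add: l 3 tpos_pm1 e)
      show ?thesis
        by (rule exI[of _ "\<alpha> - e"], rule exI[of _ "\<beta> - (\<alpha> - e)"], rule exI[of _ "\<gamma> - (\<beta> - (\<alpha> - e))"])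
          (simp only: C D S IH(1) G.inv_a_nf IH(2-4) e, simp add: e_def algebra_simps)
    qed
  qed
  then show ?thesis using that by blast
qed

text \<open>The power sums are invariants by the action of the letters; conversely they determine
  the exponents of the normal form.\<close>

lemma pres_eq_iff_same_moments: "pres_eq rels v w \<longleftrightarrow> same_moments 3 v w"
proof
  assume *: "same_moments 3 v w"
  obtain \<alpha> \<beta> \<gamma> where v: "pres_class rels v = G.nf (odd (tcount v)) (disp v) \<alpha> \<beta> \<gamma>"
    "psum 1 v = (2 * psum 0 v - 1) * \<alpha>"
    "psum 2 v = psum 1 v + 2 * (2 * psum 0 v - 1) * \<beta>"
    "psum 3 v = 3 * psum 2 v - 2 * psum 1 v + 6 * (2 * psum 0 v - 1) * \<gamma>" by (rule class_nf)
  obtain \<alpha>' \<beta>' \<gamma>' where w: "pres_class rels w = G.nf (odd (tcount w)) (disp w) \<alpha>' \<beta>' \<gamma>'"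
    "psum 1 w = (2 * psum 0 w - 1) * \<alpha>'"
    "psum 2 w = psum 1 w + 2 * (2 * psum 0 w - 1) * \<beta>'"
    "psum 3 w = 3 * psum 2 w - 2 * psum 1 w + 6 * (2 * psum 0 w - 1) * \<gamma>'" by (rule class_nf)
  have odd: "odd (tcount v) = odd (tcount w)"
    using * by (auto simp: same_moments_3 same_moments_2 alt_0 split: if_splits)
  have ne: "2 * psum 0 w - 1 \<noteq> 0" by (simp add: alt_0)
  have "\<alpha> = \<alpha>'" "\<beta> = \<beta>'" "\<gamma> = \<gamma>'"
    using * v w ne by (auto simp: same_moments_3 same_moments_2)
  then have "pres_class rels v = pres_class rels w"
    using * v(1) w(1) odd by (simp add: same_moments_3 same_moments_2)
  then show "pres_eq rels v w" by (simp add: pres_class_eq_iff)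
qed (rule pres_eq_imp_same_moments)

text \<open>The last exponent of the normal form is an integer, so the lower power sums fix the
  third one modulo 6. Hence every discrepancy that remains is a multiple of 6, which is what central
  words can repair.\<close>

lemma psum3_diff_dvd:
  assumes "same_moments 2 v w"
  shows "6 dvd psum 3 v - psum 3 w"
proof -
  have "6 dvd psum 3 w - (3 * psum 2 w - 2 * psum 1 w)" for w
    by (rule class_nf[of w]) simp
  from dvd_diff[OF this[of v] this[of w]] show ?thesis
    using assms by (simp add: same_moments_2)
qed

section \<open>Geodesic words\<close>

abbreviation gens :: "gen word set set" where
  "gens \<equiv> {elt_a, inv\<^bsub>grp\<^esub> elt_a, elt_t}"

definition eval_letter :: "gen \<times> bool \<Rightarrow> gen word set" where
  "eval_letter l = pres_class rels [l]"

definition minimal :: "gen word \<Rightarrow> bool" where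
  "minimal w \<longleftrightarrow> (\<forall>w'. same_moments 3 w w' \<longrightarrow> length w \<le> length w')"

lemma gens_eq: "gens = range eval_letter"
proof -
  have "l \<in> {(Gen_a, True), (Gen_a, False), (Gen_t, True), (Gen_t, False)}" for l :: "gen \<times> bool"
    by (cases l; cases "fst l") auto
  then have "range eval_letter = eval_letter ` {(Gen_a, True), (Gen_a, False), (Gen_t, True), (Gen_t, False)}"
    by blast
  also have "\<dots> = gens"
    by (simp add: eval_letter_def class_letter)
  finally show ?thesis by simp
qed

lemma word_eval_map: "word_eval grp (map eval_letter w) = pres_class rels w"
  by (induction w) (simp_all add: word_eval_def grp_one eval_letter_def grp_mult)

lemma geodesic_map_iff: "geodesic grp gens (map eval_letter w) \<longleftrightarrow> minimal w"
proof -
  define g where "g = pres_class rels w"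
  have "word_eval grp (map eval_letter w') = g \<longleftrightarrow> same_moments 3 w w'" for w'
    unfolding word_eval_map g_def pres_class_eq_iff pres_eq_iff_same_moments
    by (auto simp: same_moments_def)
  then have "(\<exists>W\<in>lists gens. word_eval grp W = g \<and> length W = n)
      \<longleftrightarrow> (\<exists>w'. same_moments 3 w w' \<and> length w' = n)" for n
    unfolding gens_eq lists_image lists_UNIV by simp
  then have "word_norm grp gens g = (LEAST n. \<exists>w'. same_moments 3 w w' \<and> length w' = n)"
    by (simp add: word_norm_def)
  also have "length w = \<dots> \<longleftrightarrow> minimal w"
  proof
    assume *: "length w = (LEAST n. \<exists>w'. same_moments 3 w w' \<and> length w' = n)"
    show "minimal w" unfolding minimal_def
      by (subst *) (auto intro: Least_le)
  next
    assume "minimal w"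
    then show "length w = (LEAST n. \<exists>w'. same_moments 3 w w' \<and> length w' = n)"
      by (intro Least_equality[symmetric]) (auto simp: minimal_def same_moments_def)
  qed
  finally show ?thesis
    by (simp add: geodesic_def word_eval_map g_def gens_eq lists_image lists_UNIV)
qed

lemma geodesics_eq:
  "{W. geodesic grp gens W \<and> length W \<le> n} = map eval_letter ` {w. minimal w \<and> length w \<le> n}"
proof (intro equalityI subsetI)
  fix W assume W: "W \<in> {W. geodesic grp gens W \<and> length W \<le> n}"
  then have "W \<in> range (map eval_letter)"
    by (simp add: geodesic_def gens_eq lists_image lists_UNIV)
  then obtain w where "W = map eval_letter w" by blast
  with W show "W \<in> map eval_letter ` {w. minimal w \<and> length w \<le> n}"
    using geodesic_map_iff by auto
qed (use geodesic_map_iff in auto)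

text \<open>The two formal letters for \<open>t\<close> have the same value, so a word over the
  generators does not determine the formal word, but it does determine the positions. This gives
  injectivity when geodesics are counted.\<close>

lemma tpos_eval_letter:
  assumes "map eval_letter v = map eval_letter w"
  shows "tpos u v = tpos u w"
proof -
  have letter: "same_moments 3 [l] [l']" if "eval_letter l = eval_letter l'" for l l'
    using that by (simp add: eval_letter_def pres_class_eq_iff pres_eq_iff_same_moments)
  show ?thesis
    using assms
  proof (induction v arbitrary: w u)
    case (Cons l v)
    then obtain l' w' where w: "w = l' # w'" and eq: "eval_letter l = eval_letter l'"
      and "map eval_letter v = map eval_letter w'" by (cases w) auto
    then have IH: "tpos u v = tpos u w'" for u using Cons.IH by blast
    obtain x b y b' where l: "l = (x, b)" "l' = (y, b')" by (cases l, cases l')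
    show ?case using letter[OF eq] IH
      by (cases x; cases y; cases b; cases b') (simp_all add: w l same_moments_3 same_moments_2)
  qed simp
qed

section \<open>Many geodesics\<close>

definition apow :: "int \<Rightarrow> gen word" where
  "apow e = replicate (nat \<bar>e\<bar>) (Gen_a, 0 \<le> e)"

text \<open>Once every second position has changed its sign, the distance of neighbouring positions
  becomes the absolute value of a sum. So \<open>travel 0\<close> is the length of the tour from 0
  through all positions and back to 0.\<close>

fun travel :: "int \<Rightarrow> int list \<Rightarrow> int" where
  "travel c [] = \<bar>c\<bar>"
| "travel c (q # qs) = \<bar>c + q\<bar> + travel q qs"

fun alternate :: "int list \<Rightarrow> int list" where
  "alternate [] = []"
| "alternate (p # ps) = p # map uminus (alternate ps)"

fun zigzag :: "int \<Rightarrow> int list \<Rightarrow> gen word" where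
  "zigzag u [] = apow (- u)"
| "zigzag u (p # ps) = apow (p - u) @ wt @ zigzag p ps"

lemma length_apow [simp]: "length (apow e) = nat \<bar>e\<bar>"
  by (simp add: apow_def)

lemma disp_replicate: "disp (replicate n (Gen_a, b)) = (if b then int n else - int n)"
  by (induction n) auto

lemma disp_apow [simp]: "disp (apow e) = e"
  by (simp add: apow_def disp_replicate)

lemma tpos_replicate: "tpos u (replicate n (Gen_a, b)) = []"
  by (induction n arbitrary: u) auto

lemma tpos_apow [simp]: "tpos u (apow e) = []"
  by (simp add: apow_def tpos_replicate)

lemma tpos_zigzag [simp]: "tpos u (zigzag u ps) = ps"
  by (induction u ps rule: zigzag.induct) simp_all

lemma disp_zigzag [simp]: "disp (zigzag u ps) = - u"
  by (induction u ps rule: zigzag.induct) simp_all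

lemma alternate_alternate [simp]: "alternate (alternate ps) = ps"
proof (induction ps)
  case (Cons p ps)
  have "alternate (map uminus qs) = map uminus (alternate qs)" for qs
    by (induction qs) auto
  with Cons show ?case by (simp add: comp_def)
qed simp

lemma length_alternate [simp]: "length (alternate ps) = length ps"
  by (induction ps) auto

lemma travel_uminus: "travel (- c) (map uminus qs) = travel c qs"
  by (induction c qs rule: travel.induct) simp_all

lemma length_zigzag: "int (length (zigzag u ps)) = travel (- u) (alternate ps) + int (length ps)"
proof (induction u ps rule: zigzag.induct)
  case (2 u p ps)
  then show ?case using travel_uminus[of "- p" "alternate ps"] by simp
qed simp

text \<open>The sign changes of the entries absorb the alternating signs, so the first and third
  power sums become plain sums.\<close>

lemma alt_odd: "odd j \<Longrightarrow> alt j ps = (\<Sum>q\<leftarrow>alternate ps. q ^ j)"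
proof (induction ps)
  case (Cons p ps)
  have "(\<Sum>q\<leftarrow>map uminus qs. q ^ j) = - (\<Sum>q\<leftarrow>qs. q ^ j)" for qs :: "int list"
    using \<open>odd j\<close> by (induction qs) simp_all
  with Cons show ?case by (simp add: comp_def)
qed simp

lemma travel_shift: "travel (c + e) qs \<le> travel c qs + \<bar>e\<bar>"
  by (cases qs) simp_all

lemma length_ge_travel:
  assumes "u + disp w = 0"
  shows "travel (- u) (alternate (tpos u w)) + int (tcount w) \<le> int (length w)"
  using assms
proof (induction u w rule: tpos.induct)
  case (2 u b w)
  then show ?case
    using travel_shift[of "- (u + (if b then 1 else -1))" "if b then 1 else -1" "alternate (tpos (u + (if b then 1 else -1)) w)"]
    by (auto split: if_splits)
next
  case (3 u b w)
  then show ?case using travel_uminus[of "- u" "alternate (tpos u w)"] by simp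
qed simp

section \<open>Inequalities for sums of cubes along a tour\<close>

text \<open>The right-hand side is the tangent at \<open>x = y = s\<close>; the last term, which vanishes for
  \<open>x + y \<ge> 0\<close>, pays for the steps taken in the wrong direction.\<close>

lemma cube_sum_ge:
  fixes s x y U :: int
  assumes "0 \<le> s" "\<bar>x\<bar> \<le> U" "\<bar>y\<bar> \<le> U"
  shows "2 * (x ^ 3 + y ^ 3) \<ge> 6 * s\<^sup>2 * (x + y) - 8 * s ^ 3 - 3 * U\<^sup>2 * (\<bar>x + y\<bar> - (x + y))"
proof (cases "0 \<le> x + y")
  case True
  define S where "S = x + y"
  have "4 * (x ^ 3 + y ^ 3) = S ^ 3 + 3 * S * (x - y)\<^sup>2"
    by (simp add: S_def algebra_simps power2_eq_square power3_eq_cube)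
  moreover have "0 \<le> 3 * S * (x - y)\<^sup>2" using True S_def by simp
  moreover have "S ^ 3 - 12 * s\<^sup>2 * S + 16 * s ^ 3 = (S - 2 * s)\<^sup>2 * (S + 4 * s)"
    by (simp add: algebra_simps power2_eq_square power3_eq_cube)
  moreover have "0 \<le> (S - 2 * s)\<^sup>2 * (S + 4 * s)" using True S_def assms by simp
  ultimately have "2 * (x ^ 3 + y ^ 3) \<ge> 6 * s\<^sup>2 * S - 8 * s ^ 3" by linarith
  then show ?thesis using True by (simp add: S_def)
next
  case False
  define S where "S = - (x + y)"
  have S: "0 \<le> S" using False S_def by simp
  have "\<bar>x\<bar>\<^sup>2 \<le> U\<^sup>2" "\<bar>y\<bar>\<^sup>2 \<le> U\<^sup>2" using assms by (intro power_mono; simp)+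
  moreover have "\<bar>x * y\<bar> \<le> U\<^sup>2"
    unfolding abs_mult power2_eq_square using assms by (intro mult_mono) auto
  ultimately have "x\<^sup>2 - x * y + y\<^sup>2 \<le> 3 * U\<^sup>2" by simp
  then have "S * (x\<^sup>2 - x * y + y\<^sup>2) \<le> S * (3 * U\<^sup>2)" using S by (rule mult_left_mono)
  also have "S * (x\<^sup>2 - x * y + y\<^sup>2) = - (x ^ 3 + y ^ 3)"
    by (simp add: S_def algebra_simps power2_eq_square power3_eq_cube)
  finally have "- (x ^ 3 + y ^ 3) \<le> S * (3 * U\<^sup>2)" .
  moreover have "0 \<le> s\<^sup>2 * S" "0 \<le> s ^ 3" using S assms by simp_all
  moreover have "- X \<le> Y \<Longrightarrow> 0 \<le> A \<Longrightarrow> 0 \<le> B \<Longrightarrow> 2 * X \<ge> - 6 * A - 8 * B - 2 * Y" for X Y A B :: int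
    by linarith
  ultimately have "2 * (x ^ 3 + y ^ 3) \<ge> - 6 * (s\<^sup>2 * S) - 8 * s ^ 3 - 2 * (S * (3 * U\<^sup>2))"
    by blast
  also have "- 6 * (s\<^sup>2 * S) - 8 * s ^ 3 - 2 * (S * (3 * U\<^sup>2))
      = 6 * s\<^sup>2 * (- S) - 8 * s ^ 3 - 3 * U\<^sup>2 * (S - (- S))" by (simp add: algebra_simps)
  finally have "2 * (x ^ 3 + y ^ 3) \<ge> 6 * s\<^sup>2 * (- S) - 8 * s ^ 3 - 3 * U\<^sup>2 * (S - (- S))" .
  moreover have "x + y = - S" by (simp add: S_def)
  ultimately show ?thesis using S by simp
qed

lemma cube_ge:
  fixes s x U :: int
  assumes "0 \<le> s" "\<bar>x\<bar> \<le> U"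
  shows "2 * x ^ 3 \<ge> 6 * s\<^sup>2 * x - 4 * s ^ 3 - 3 * U\<^sup>2 * (\<bar>x\<bar> - x)"
proof (cases "0 \<le> x")
  case True
  have "x ^ 3 - 3 * s\<^sup>2 * x + 2 * s ^ 3 = (x - s)\<^sup>2 * (x + 2 * s)"
    by (simp add: algebra_simps power2_eq_square power3_eq_cube)
  moreover have "0 \<le> (x - s)\<^sup>2 * (x + 2 * s)" using True assms by simp
  ultimately show ?thesis using True by simp
next
  case False
  define y where "y = - x"
  have y: "0 \<le> y" "y \<le> U" using False assms y_def by simp_all
  then have "y * y\<^sup>2 \<le> y * U\<^sup>2" by (intro mult_left_mono power_mono)
  moreover have "0 \<le> s\<^sup>2 * y" "0 \<le> s ^ 3" "0 \<le> y * U\<^sup>2" using y assms by simp_all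
  ultimately have "2 * (- (y ^ 3)) \<ge> 6 * s\<^sup>2 * (- y) - 4 * s ^ 3 - 3 * U\<^sup>2 * (y - - y)"
    by (simp add: power3_eq_cube power2_eq_square algebra_simps)
  then show ?thesis using y by (simp add: y_def)
qed

text \<open>\<open>cube_sum_ge\<close> is summed over neighbouring entries; every entry after
  \<open>c\<close> lies in two pairs, except that the end of the tour is left to
  \<open>cube_ge\<close>. The penalties add up to the excess of \<open>travel\<close>.\<close>

lemma sum_cubes_ge_aux:
  fixes s U :: int
  assumes "0 \<le> s" "\<bar>c\<bar> \<le> U" "\<forall>q\<in>set qs. \<bar>q\<bar> \<le> U"
  shows "2 * (c ^ 3 + 2 * (\<Sum>q\<leftarrow>qs. q ^ 3)) \<ge> 6 * s\<^sup>2 * (c + 2 * sum_list qs) - 8 * s ^ 3 * int (length qs)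
    - 4 * s ^ 3 - 3 * U\<^sup>2 * (travel c qs - (c + 2 * sum_list qs))"
  using assms
proof (induction c qs rule: travel.induct)
  case (1 c)
  then show ?case using cube_ge[of s c U] by simp
next
  case (2 c q qs)
  then show ?case using cube_sum_ge[of s c U q] by (simp add: algebra_simps)
qed

text \<open>For a fixed sum of the entries, each entry fewer raises the bound by 8 s^3, while each
  unit of excess travel lowers it by 3 U^2.\<close>

lemma sum_cubes_ge:
  fixes s U :: int
  assumes "0 \<le> s" "\<forall>q\<in>set qs. \<bar>q\<bar> \<le> U"
  shows "4 * (\<Sum>q\<leftarrow>qs. q ^ 3) \<ge> 12 * s\<^sup>2 * sum_list qs - 8 * s ^ 3 * int (length qs)
    - 3 * U\<^sup>2 * (travel 0 qs - 2 * sum_list qs)"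
proof (cases qs)
  case (Cons q qs')
  then show ?thesis
    using sum_cubes_ge_aux[of s q U qs'] cube_ge[of s q U] assms by (simp add: algebra_simps)
qed simp

lemma cube_sum_abs:
  fixes x y U :: int
  assumes "\<bar>x\<bar> \<le> U" "\<bar>y\<bar> \<le> U"
  shows "x ^ 3 + y ^ 3 \<ge> \<bar>\<bar>x\<bar> ^ 3 - \<bar>y\<bar> ^ 3\<bar> - 3 * U\<^sup>2 * (\<bar>x + y\<bar> - (x + y))"
proof -
  have *: "\<bar>\<bar>x\<bar> ^ 3 - \<bar>y\<bar> ^ 3\<bar> \<le> \<bar>x ^ 3 + y ^ 3\<bar>"
    using abs_triangle_ineq3[of "x ^ 3" "- (y ^ 3)"] by (simp add: power_abs)
  have eq: "4 * (x ^ 3 + y ^ 3) = (x + y) * ((x + y)\<^sup>2 + 3 * (x - y)\<^sup>2)"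
    by (simp add: algebra_simps power2_eq_square power3_eq_cube)
  have pos: "0 \<le> (x + y)\<^sup>2 + 3 * (x - y)\<^sup>2" by simp
  show ?thesis
  proof (cases "0 \<le> x + y")
    case True
    have "0 \<le> 4 * (x ^ 3 + y ^ 3)" unfolding eq using True pos by (rule mult_nonneg_nonneg)
    then show ?thesis using * True by simp
  next
    case False
    have "4 * (x ^ 3 + y ^ 3) \<le> 0" unfolding eq using False pos by (intro mult_nonpos_nonneg) auto
    then show ?thesis using cube_sum_ge[of 0 x U y] assms * by simp
  qed
qed

text \<open>\<open>cube_sum_abs\<close> telescopes along the tour: from |c|^3 down to 0 at the end
  in the first part, and from |c|^3 up to |r|^3 and then down to 0 in the second.\<close>

lemma travel_cubes_ge_aux:
  fixes U :: int
  assumes "\<bar>c\<bar> \<le> U" "\<forall>q\<in>set qs. \<bar>q\<bar> \<le> U"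
  shows "c ^ 3 + 2 * (\<Sum>q\<leftarrow>qs. q ^ 3) \<ge> \<bar>c\<bar> ^ 3 - 3 * U\<^sup>2 * (travel c qs - (c + 2 * sum_list qs))"
    and "r \<in> set qs \<Longrightarrow>
      c ^ 3 + 2 * (\<Sum>q\<leftarrow>qs. q ^ 3) \<ge> 2 * \<bar>r\<bar> ^ 3 - \<bar>c\<bar> ^ 3 - 3 * U\<^sup>2 * (travel c qs - (c + 2 * sum_list qs))"
  using assms
proof (induction c qs rule: travel.induct)
  case (1 c)
  {
    case 1
    then show ?case using cube_sum_abs[of c U 0] by simp
  next
    case 2
    then show ?case by simp
  }
next
  case (2 c q qs)
  {
    case 1
    then show ?case using cube_sum_abs[of c U q] 2(1) by (simp add: algebra_simps)
  next
    case 2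
    have "c ^ 3 + q ^ 3 \<ge> \<bar>q\<bar> ^ 3 - \<bar>c\<bar> ^ 3 - 3 * U\<^sup>2 * (\<bar>c + q\<bar> - (c + q))"
      using cube_sum_abs[of c U q] 2 by simp
    moreover have "q ^ 3 + 2 * (\<Sum>q\<leftarrow>qs. q ^ 3)
        \<ge> 2 * \<bar>r\<bar> ^ 3 - \<bar>q\<bar> ^ 3 - 3 * U\<^sup>2 * (travel q qs - (q + 2 * sum_list qs))"
    proof (cases "r = q")
      case True
      then show ?thesis using "2.IH"(1) 2 by simp
    next
      case False
      then show ?thesis using "2.IH"(2) 2 by simp
    qed
    ultimately show ?case by (simp add: algebra_simps)
  }
qed

text \<open>An a priori bound: a single large entry forces a large sum of cubes or much excess
  travel.\<close>

lemma travel_cubes_ge: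
  fixes U :: int
  assumes "\<forall>q\<in>set qs. \<bar>q\<bar> \<le> U" "r \<in> set qs"
  shows "2 * \<bar>r\<bar> ^ 3 \<le> 2 * (\<Sum>q\<leftarrow>qs. q ^ 3) + 3 * U\<^sup>2 * (travel 0 qs - 2 * sum_list qs)"
proof -
  have "0 \<le> U" using assms by fastforce
  then show ?thesis using travel_cubes_ge_aux(2)[of 0 U qs r] assms by simp
qed

lemma travel_ge_sum: "travel c qs \<ge> c + 2 * sum_list qs"
  by (induction c qs rule: travel.induct) simp_all


lemma travel_nonneg:
  assumes "0 \<le> c" "\<forall>q\<in>set qs. 0 \<le> q"
  shows "travel c qs = c + 2 * sum_list qs"
  using assms by (induction c qs rule: travel.induct) simp_all

lemma sum_list_affine_bound:
  fixes A B :: int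
  assumes "\<forall>h\<in>set hs. f h \<le> A * h + B"
  shows "(\<Sum>h\<leftarrow>hs. f h) \<le> A * sum_list hs + B * int (length hs)"
  using assms
proof (induction hs)
  case (Cons h hs)
  then have "f h \<le> A * h + B" "(\<Sum>h\<leftarrow>hs. f h) \<le> A * sum_list hs + B * int (length hs)" by simp_all
  then show ?case by (simp add: algebra_simps)
qed simp

text \<open>A shorter word with the same power sums has waste \<delta> and lacks at least \<delta> +
  1 turns. With tangent point \<open>s\<close> = 4 i^4 and \<open>y\<close> = i^6, the missing turns
  add 512 y^2 (\<delta> + 1) to the bound for the cubes, whereas the spread of \<open>hs\<close> and
  the waste account for at most 104 y^2 + 192 y^2 \<delta>.\<close>

lemma zigzag_minimal:
  fixes hs :: "int list" and i :: nat
  assumes i: "1 \<le> i" and len: "length hs = 2 * i ^ 6"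
    and hs: "\<forall>h\<in>set hs. 4 * int i ^ 4 \<le> h \<and> h \<le> 4 * int i ^ 4 + int i"
  shows "minimal (zigzag 0 (alternate hs))"
proof (rule ccontr)
  define w where "w = zigzag 0 (alternate hs)"
  assume "\<not> minimal (zigzag 0 (alternate hs))"
  then obtain w' where w': "same_moments 3 w w'" "length w' < length w"
    by (auto simp: minimal_def w_def not_le)
  define qs where "qs = alternate (tpos 0 w')"
  \<comment> \<open>The waste of the tour: the sum of |x + y| - (x + y) over neighbouring entries,
    with 0 at both ends.\<close>
  define \<delta> where "\<delta> = travel 0 qs - 2 * sum_list qs"
  define s where "s = 4 * int i ^ 4"
  define y where "y = int i ^ 6"
  have y: "0 < y" using i by (simp add: y_def)
  have s3: "s ^ 3 = 64 * y\<^sup>2" by (simp add: s_def y_def power_mult_distrib flip: power_mult)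
  have s_nonneg: "0 \<le> s" by (simp add: s_def)
  have hs_nonneg: "\<forall>h\<in>set hs. 0 \<le> h" using hs s_nonneg unfolding s_def by (meson order_trans)
  have len': "int (length hs) = 2 * y" by (simp add: len y_def)
  have "int (length w) = 2 * sum_list hs + 2 * y"
    using length_zigzag[of 0 "alternate hs"] travel_nonneg[of 0 hs] hs_nonneg len' by (simp add: w_def)
  moreover have "travel 0 qs + int (tcount w') \<le> int (length w')"
    using length_ge_travel[of 0 w'] w'(1) by (simp add: qs_def w_def same_moments_3 same_moments_2)
  moreover have sum_qs: "sum_list qs = sum_list hs"
    using w'(1) alt_odd[of 1 "alternate hs"] alt_odd[of 1 "tpos 0 w'"]
    by (simp add: qs_def w_def same_moments_3 same_moments_2)
  ultimately have short: "int (tcount w') + \<delta> + 1 \<le> 2 * y"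
    using w'(2) by (simp add: \<delta>_def)
  have \<delta>_nonneg: "0 \<le> \<delta>" using travel_ge_sum[of 0 qs] by (simp add: \<delta>_def)
  have cubes: "(\<Sum>q\<leftarrow>qs. q ^ 3) = (\<Sum>h\<leftarrow>hs. h ^ 3)"
    using w'(1) alt_odd[of 3 "alternate hs"] alt_odd[of 3 "tpos 0 w'"]
    by (simp add: qs_def w_def same_moments_3 same_moments_2)
  have i4: "int i \<le> int i ^ 4" using i by (intro self_le_power) simp_all
  have "h ^ 3 \<le> 0 * h + 125 * y\<^sup>2" if "h \<in> set hs" for h
  proof -
    have "h \<le> 4 * int i ^ 4 + int i" "0 \<le> h" using hs hs_nonneg that by blast+
    then have "h ^ 3 \<le> (5 * int i ^ 4) ^ 3" using i4 by (intro power_mono) linarith+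
    then show ?thesis by (simp add: y_def power_mult_distrib flip: power_mult)
  qed
  then have cubes_le: "(\<Sum>h\<leftarrow>hs. h ^ 3) \<le> 250 * y ^ 3"
    using sum_list_affine_bound[of hs "\<lambda>h. h ^ 3" 0 "125 * y\<^sup>2"] len'
    by (simp add: power2_eq_square power3_eq_cube)
  \<comment> \<open>For U at least 8 y, both 500 y^3 < U^3 and 6 U^2 y < U^3 would hold, against 2
    U^3 <= 500 y^3 + 6 U^2 y.\<close>
  obtain U where U: "\<forall>q\<in>set qs. \<bar>q\<bar> \<le> U" "0 \<le> U" "U < 8 * y"
  proof (cases "qs = []")
    case True
    then show ?thesis using that[of 0] y by simp
  next
    case False
    define U where "U = Max (abs ` set qs)"
    have "U \<in> abs ` set qs" unfolding U_def using False by (intro Max_in) auto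
    then obtain r where r: "r \<in> set qs" "\<bar>r\<bar> = U" by auto
    have le: "\<forall>q\<in>set qs. \<bar>q\<bar> \<le> U" by (simp add: U_def)
    have "U < 8 * y"
    proof (rule ccontr)
      assume "\<not> U < 8 * y"
      then have ge: "8 * y \<le> U" by simp
      have "2 * U ^ 3 \<le> 2 * (\<Sum>q\<leftarrow>qs. q ^ 3) + 3 * U\<^sup>2 * \<delta>"
        using travel_cubes_ge[OF le r(1)] by (simp add: r(2) \<delta>_def)
      also have "\<dots> \<le> 500 * y ^ 3 + 3 * U\<^sup>2 * (2 * y)"
        using cubes_le short by (intro add_mono mult_left_mono) (simp_all add: cubes)
      finally have "2 * U ^ 3 \<le> 500 * y ^ 3 + 6 * (U\<^sup>2 * y)" by (simp add: algebra_simps)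
      moreover have "U\<^sup>2 * (8 * y) \<le> U\<^sup>2 * U" using ge by (intro mult_left_mono) simp_all
      then have "8 * (U\<^sup>2 * y) \<le> U ^ 3" by (simp add: power2_eq_square power3_eq_cube)
      moreover have "(8 * y) ^ 3 \<le> U ^ 3" using ge y by (intro power_mono) simp_all
      then have "512 * y ^ 3 \<le> U ^ 3" by (simp add: power_mult_distrib)
      moreover have "0 < y ^ 3" using y by simp
      ultimately show False by linarith
    qed
    then show ?thesis using that[of U] le r by auto
  qed
  have "12 * s\<^sup>2 * sum_list hs - 8 * s ^ 3 * int (tcount w') - 3 * U\<^sup>2 * \<delta> \<le> 4 * (\<Sum>h\<leftarrow>hs. h ^ 3)"
    using sum_cubes_ge[OF s_nonneg U(1)] by (simp add: sum_qs cubes \<delta>_def) (simp add: qs_def)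
  \<comment> \<open>The entries lie within \<open>i\<close> of the tangent point, so the error of
    the tangent is at most 12 s i^2 + 4 i^3 <= 48 y + 4 y.\<close>
  moreover have "4 * h ^ 3 \<le> 12 * s\<^sup>2 * h + (52 * y - 8 * s ^ 3)" if "h \<in> set hs" for h
  proof -
    define \<epsilon> where "\<epsilon> = h - s"
    have \<epsilon>: "0 \<le> \<epsilon>" "\<epsilon> \<le> int i" using hs that by (fastforce simp: \<epsilon>_def s_def)+
    have "4 * h ^ 3 - 12 * s\<^sup>2 * h + 8 * s ^ 3 = 12 * s * \<epsilon>\<^sup>2 + 4 * \<epsilon> ^ 3"
      by (simp add: \<epsilon>_def algebra_simps power2_eq_square power3_eq_cube)
    also have "\<dots> \<le> 12 * s * (int i)\<^sup>2 + 4 * int i ^ 3"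
      using \<epsilon> s_nonneg by (intro add_mono mult_left_mono power_mono) simp_all
    also have "\<dots> = 48 * y + 4 * int i ^ 3" by (simp add: s_def y_def flip: power_add)
    also have "int i ^ 3 \<le> y" unfolding y_def using i by (intro power_increasing) simp_all
    finally show ?thesis by simp
  qed
  then have "4 * (\<Sum>h\<leftarrow>hs. h ^ 3) \<le> 12 * s\<^sup>2 * sum_list hs + (52 * y - 8 * s ^ 3) * (2 * y)"
    using sum_list_affine_bound[of hs "\<lambda>h. 4 * h ^ 3" "12 * s\<^sup>2" "52 * y - 8 * s ^ 3"] len'
    by (simp add: sum_list_const_mult)
  ultimately have "8 * s ^ 3 * (2 * y - int (tcount w')) \<le> 104 * y\<^sup>2 + 3 * (U\<^sup>2 * \<delta>)"
    by (simp add: algebra_simps power2_eq_square)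
  moreover have "U\<^sup>2 * \<delta> \<le> (8 * y)\<^sup>2 * \<delta>"
    using U \<delta>_nonneg by (intro mult_right_mono power_mono) simp_all
  moreover have "8 * s ^ 3 * (2 * y - int (tcount w')) \<ge> 8 * s ^ 3 * (\<delta> + 1)"
    using short s_nonneg by (intro mult_left_mono) simp_all
  ultimately have "y\<^sup>2 * (512 * (\<delta> + 1)) \<le> y\<^sup>2 * (104 + 192 * \<delta>)"
    unfolding s3 by (simp add: algebra_simps power2_eq_square)
  then have "512 * (\<delta> + 1) \<le> 104 + 192 * \<delta>"
    using y by (simp only: mult_le_cancel_left_pos zero_less_power)
  then show False using \<delta>_nonneg by simp
qed

lemma finite_geodesics: "finite {W. geodesic grp gens W \<and> length W \<le> n}"
  by (rule finite_subset[OF _ finite_lists_length_le[of gens n]]) (auto simp: geodesic_def in_lists_conv_set)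

text \<open>The 2 i^6 entries are at most 5 i^4 each, so the tour has length at most 20 i^10, and
  the turns add 2 i^6.\<close>

lemma geodesic_growth_ge:
  assumes i: "1 \<le> i"
  shows "(i + 1) ^ (2 * i ^ 6) \<le> geodesic_growth grp gens (22 * i ^ 10)"
proof -
  define A where "A = {4 * int i ^ 4..4 * int i ^ 4 + int i}"
  define H where "H = {hs. set hs \<subseteq> A \<and> length hs = 2 * i ^ 6}"
  define f where "f hs = map eval_letter (zigzag 0 (alternate hs))" for hs
  have "inj_on f H"
  proof (rule inj_onI)
    fix hs hs' assume "f hs = f hs'"
    then have "tpos 0 (zigzag 0 (alternate hs)) = tpos 0 (zigzag 0 (alternate hs'))"
      unfolding f_def by (rule tpos_eval_letter)
    then show "hs = hs'" by (metis tpos_zigzag alternate_alternate)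
  qed
  then have "card H = card (f ` H)" by (simp add: card_image)
  also have "\<dots> \<le> card {W. geodesic grp gens W \<and> length W \<le> 22 * i ^ 10}"
  proof (intro card_mono finite_geodesics subsetI)
    fix W assume "W \<in> f ` H"
    then obtain hs where hs: "set hs \<subseteq> A" "length hs = 2 * i ^ 6" and W: "W = f hs" by (auto simp: H_def)
    have min: "minimal (zigzag 0 (alternate hs))"
      using hs by (intro zigzag_minimal[OF i]) (auto simp: A_def)
    have "0 \<le> h" if "h \<in> A" for h
    proof (rule order_trans)
      show "0 \<le> 4 * int i ^ 4" "4 * int i ^ 4 \<le> h" using that by (simp_all add: A_def)
    qed
    then have nonneg: "\<forall>h\<in>set hs. 0 \<le> h" using hs(1) by blast
    have i4: "int i \<le> int i ^ 4" using i by (intro self_le_power) simp_all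
    have "h \<le> 0 * h + 5 * int i ^ 4" if "h \<in> A" for h
    proof -
      have "h \<le> 4 * int i ^ 4 + int i" using that by (simp add: A_def)
      with i4 show ?thesis by linarith
    qed
    then have "\<forall>h\<in>set hs. h \<le> 0 * h + 5 * int i ^ 4" using hs(1) by blast
    from sum_list_affine_bound[of hs "\<lambda>h. h", OF this]
    have "sum_list hs \<le> 10 * int i ^ 10" by (simp add: hs(2) flip: power_add)
    moreover have "int i ^ 6 \<le> int i ^ 10" using i by (intro power_increasing) simp_all
    ultimately have "int (length (zigzag 0 (alternate hs))) \<le> 22 * int i ^ 10"
      unfolding length_zigzag using travel_nonneg[of 0 hs] nonneg hs(2) by simp
    also have "\<dots> = int (22 * i ^ 10)" by simp
    finally have "length (zigzag 0 (alternate hs)) \<le> 22 * i ^ 10" by (simp only: of_nat_le_iff)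
    with min show "W \<in> {W. geodesic grp gens W \<and> length W \<le> 22 * i ^ 10}"
      by (simp add: W f_def geodesic_map_iff)
  qed
  finally have "card H \<le> geodesic_growth grp gens (22 * i ^ 10)" by (simp add: geodesic_growth_def)
  moreover have "card A = i + 1" by (simp add: A_def)
  then have "card H = (i + 1) ^ (2 * i ^ 6)"
    unfolding H_def by (subst card_lists_length_eq) (simp_all add: A_def)
  ultimately show ?thesis by simp
qed

section \<open>Words modulo the centre\<close>

abbreviation acount :: "gen word \<Rightarrow> nat" where
  "acount w \<equiv> length (filter (\<lambda>l. fst l = Gen_a) w)"

text \<open>Modulo the centre, reading the letters \<open>a\<close> after an even number of letters \<open>t\<close> as
  horizontal and the others as vertical unit steps turns a word into a lattice path, and its
  element is determined by the endpoint and the signed area \<open>\<integral> y dx\<close>.\<close>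

definition height :: "gen word \<Rightarrow> int" where
  "height w = (if even (tcount w) then 0 else disp w) - psum 1 w"

definition area2 :: "gen word \<Rightarrow> int" where
  "area2 w = psum 2 w - (psum 1 w)\<^sup>2 - (if even (tcount w) then 2 * psum 1 w * disp w else 0)"

lemma length_counts: "length w = acount w + tcount w"
proof (induction w)
  case (Cons l w)
  then show ?case by (cases "fst l") simp_all
qed simp

lemma same_moments_2_iff:
  "same_moments 2 v w \<longleftrightarrow> even (tcount v) = even (tcount w) \<and> disp v = disp w
    \<and> height v = height w \<and> area2 v = area2 w"
  by (auto simp: same_moments_2 height_def area2_def alt_0)

lemma height_snoc:
  "height (w @ [(Gen_t, b)]) = height w"
  "height (w @ [(Gen_a, b)]) = height w + (if even (tcount w) then 0 else if b then 1 else -1)"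
  by (simp_all add: height_def alt_append)

text \<open>A horizontal step sweeps the current height, so \<open>area2\<close> is twice the signed
  area and stays an integer combination of power sums.\<close>

lemma area2_snoc:
  "area2 (w @ [(Gen_t, b)]) = area2 w"
  "area2 (w @ [(Gen_a, b)]) = area2 w + (if even (tcount w) then 2 * (if b then 1 else -1) * height w else 0)"
  by (simp_all add: height_def area2_def alt_append algebra_simps power2_eq_square)

text \<open>\<open>R\<close> and \<open>L\<close> are the numbers of steps to the right and to the left, \<open>lo\<close> and \<open>hi\<close> the
  extremal heights.\<close>

lemma path_bounds:
  obtains R L lo hi :: int where "0 \<le> R" "0 \<le> L" "lo \<le> 0" "0 \<le> hi"
    "lo \<le> height w" "height w \<le> hi" "R - L = disp w - height w"
    "2 * (R * lo - L * hi) \<le> area2 w" "area2 w \<le> 2 * (R * hi - L * lo)"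
    "R + L + 2 * (hi - lo) - \<bar>height w\<bar> \<le> int (acount w)"
proof -
  have "\<exists>R L lo hi :: int. 0 \<le> R \<and> 0 \<le> L \<and> lo \<le> 0 \<and> 0 \<le> hi \<and> lo \<le> height w \<and> height w \<le> hi
    \<and> R - L = disp w - height w \<and> 2 * (R * lo - L * hi) \<le> area2 w \<and> area2 w \<le> 2 * (R * hi - L * lo)
    \<and> R + L + 2 * (hi - lo) - \<bar>height w\<bar> \<le> int (acount w)"
  proof (induction w rule: rev_induct)
    case Nil
    show ?case by (intro exI[of _ 0]) (simp add: height_def area2_def)
  next
    case (snoc l w)
    then obtain R L lo hi :: int where IH: "0 \<le> R" "0 \<le> L" "lo \<le> 0" "0 \<le> hi"
      "lo \<le> height w" "height w \<le> hi" "R - L = disp w - height w"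
      "2 * (R * lo - L * hi) \<le> area2 w" "area2 w \<le> 2 * (R * hi - L * lo)"
      "R + L + 2 * (hi - lo) - \<bar>height w\<bar> \<le> int (acount w)" by blast
    obtain x b where l: "l = (x, b)" by (cases l)
    consider "x = Gen_t" | "x = Gen_a" "even (tcount w)" "b" | "x = Gen_a" "even (tcount w)" "\<not> b"
      | "x = Gen_a" "odd (tcount w)" by (cases x) auto
    then show ?case
    proof cases
      case 1
      show ?thesis
        by (rule exI[of _ R], rule exI[of _ L], rule exI[of _ lo], rule exI[of _ hi])
          (use IH 1 in \<open>simp add: l height_snoc area2_snoc\<close>)
    next
      case 2
      show ?thesis
        by (rule exI[of _ "R + 1"], rule exI[of _ L], rule exI[of _ lo], rule exI[of _ hi])
          (use IH 2 in \<open>simp add: l height_snoc area2_snoc algebra_simps\<close>)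
    next
      case 3
      show ?thesis
        by (rule exI[of _ R], rule exI[of _ "L + 1"], rule exI[of _ lo], rule exI[of _ hi])
          (use IH 3 in \<open>simp add: l height_snoc area2_snoc algebra_simps\<close>)
    next
      case 4
      define e :: int where "e = (if b then 1 else -1)"
      have e: "e = 1 \<or> e = -1" by (simp add: e_def)
      define hi' where "hi' = max hi (height w + e)"
      define lo' where "lo' = min lo (height w + e)"
      have "R * hi \<le> R * hi'" "R * lo' \<le> R * lo" "L * hi \<le> L * hi'" "L * lo' \<le> L * lo"
        using IH by (auto intro!: mult_left_mono simp: hi'_def lo'_def)
      moreover have "lo' \<le> 0" "0 \<le> hi'" using IH by (simp_all add: hi'_def lo'_def)
      \<comment> \<open>A step that widens the range of heights also moves away from 0, so one copy
        of the two new units is offset by the growth of the absolute height.\<close>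
      moreover have "R + L + 2 * (hi' - lo') - \<bar>height w + e\<bar> \<le> int (acount w) + 1"
        using IH e by (auto simp: hi'_def lo'_def max_def min_def abs_if split: if_splits)
      ultimately show ?thesis
        by - (rule exI[of _ R], rule exI[of _ L], rule exI[of _ lo'], rule exI[of _ hi'],
          use IH e in \<open>simp add: l 4 height_snoc area2_snoc hi'_def lo'_def flip: e_def\<close>)
    qed
  qed
  then show ?thesis using that by blast
qed

section \<open>Rebuilding a lattice path with few corners\<close>

definition passes :: "gen word \<Rightarrow> int \<Rightarrow> int \<Rightarrow> bool" where
  "passes w lo hi \<longleftrightarrow> (\<forall>q. lo \<le> q \<and> q \<le> hi \<longrightarrow> (\<exists>u v. w = u @ v \<and> height u = q))"

text \<open>If the path is running vertically after \<open>u\<close>, two letters \<open>t\<close>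
  switch the direction and back; what follows keeps its direction in either case.\<close>

definition horizontal :: "gen word \<Rightarrow> int \<Rightarrow> gen word" where
  "horizontal u r = (if even (tcount u) then apow r else wt @ apow r @ wt)"

lemma fst_apow: "l \<in> set (apow r) \<Longrightarrow> fst l = Gen_a"
  by (auto simp: apow_def)

lemma tcount_apow [simp]: "tcount (apow r) = 0"
  by (auto simp: filter_empty_conv dest: fst_apow)

lemma acount_apow [simp]: "acount (apow r) = nat \<bar>r\<bar>"
  using length_counts[of "apow r"] by simp

text \<open>Steps inserted at a given height translate the rest of the path horizontally and add a
  rectangle to the area.\<close>

lemma
  shows even_tcount_insert: "even (tcount (u @ horizontal u r @ v)) = even (tcount (u @ v))"
    and disp_insert: "disp (u @ horizontal u r @ v) = disp (u @ v) + r"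
    and height_insert: "height (u @ horizontal u r @ v) = height (u @ v)"
    and area2_insert: "area2 (u @ horizontal u r @ v) = area2 (u @ v) + 2 * r * height u"
    and acount_insert: "int (acount (u @ horizontal u r @ v)) = int (acount (u @ v)) + \<bar>r\<bar>"
    and tcount_insert: "tcount (u @ horizontal u r @ v) \<le> tcount (u @ v) + 2"
proof -
  show ev: "even (tcount (u @ horizontal u r @ v)) = even (tcount (u @ v))"
    and d: "disp (u @ horizontal u r @ v) = disp (u @ v) + r"
    and "int (acount (u @ horizontal u r @ v)) = int (acount (u @ v)) + \<bar>r\<bar>"
    and "tcount (u @ horizontal u r @ v) \<le> tcount (u @ v) + 2"
    by (simp_all add: horizontal_def)
  have h: "tpos 0 (horizontal u r) = (if even (tcount u) then [] else [0, r])"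
    "disp (horizontal u r) = r" "even (tcount (horizontal u r))"
    by (simp_all add: horizontal_def)
  have H: "psum 0 (horizontal u r) = 0"
    "psum 1 (horizontal u r) = (if even (tcount u) then 0 else - r)"
    "psum 2 (horizontal u r) = (if even (tcount u) then 0 else - r\<^sup>2)"
    by (simp_all add: h)
  have v: "psum 0 v = (if even (tcount v) then 0 else 1)" by (simp add: alt_0)
  show "height (u @ horizontal u r @ v) = height (u @ v)"
    unfolding height_def ev d psum_append H v using h by (simp add: algebra_simps)
  show "area2 (u @ horizontal u r @ v) = area2 (u @ v) + 2 * r * height u"
    unfolding height_def area2_def ev d psum_append H v using h
    by (simp add: algebra_simps power2_eq_square)
qed

lemma passes_insert:
  assumes "passes (u @ v) lo hi"
  shows "passes (u @ horizontal u r @ v) lo hi"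
  unfolding passes_def
proof (intro allI impI)
  fix q assume "lo \<le> q \<and> q \<le> hi"
  then obtain u' v' where uv: "u @ v = u' @ v'" and q: "height u' = q"
    using assms unfolding passes_def by blast
  from uv obtain x where "u = u' @ x \<and> x @ v = v' \<or> u @ x = u' \<and> v = x @ v'"
    by (auto simp: append_eq_append_conv2)
  then show "\<exists>u' v'. u @ horizontal u r @ v = u' @ v' \<and> height u' = q"
  proof
    assume "u = u' @ x \<and> x @ v = v'"
    then show ?thesis using q by (intro exI[of _ u'] exI[of _ "x @ horizontal u r @ v"]) auto
  next
    assume "u @ x = u' \<and> v = x @ v'"
    then show ?thesis using q height_insert[of u r x]
      by (intro exI[of _ "u @ horizontal u r @ x"] exI[of _ v']) auto
  qed
qed

lemma insert_horizontal:
  assumes "passes w lo hi" "lo \<le> q" "q \<le> hi"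
  obtains w' where "even (tcount w') = even (tcount w)" "disp w' = disp w + r" "height w' = height w"
    "area2 w' = area2 w + 2 * r * q" "int (acount w') = int (acount w) + \<bar>r\<bar>"
    "tcount w' \<le> tcount w + 2" "passes w' lo hi"
proof -
  obtain u v where uv: "w = u @ v" "height u = q" using assms unfolding passes_def by blast
  show ?thesis
    by (rule that[of "u @ horizontal u r @ v"])
      (use uv assms(1) in \<open>simp_all only: even_tcount_insert disp_insert height_insert area2_insert
        acount_insert tcount_insert passes_insert\<close>)
qed

text \<open>An integer between R lo and R hi is a sum of R heights that take only two neighbouring
  values, so R horizontal steps need to be placed at two heights only.\<close>

lemma balanced_sum:
  fixes R N lo hi :: int
  assumes "0 \<le> R" "lo \<le> 0" "0 \<le> hi" "R * lo \<le> N" "N \<le> R * hi"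
  obtains q r where "0 \<le> r" "r \<le> R" "lo \<le> q" "q \<le> hi" "r = 0 \<or> q + 1 \<le> hi" "N = q * R + r"
proof (cases "R = 0")
  case True
  then show ?thesis using that[of 0 0] assms by simp
next
  case False
  then have R: "0 < R" using assms by simp
  have N: "N = N div R * R + N mod R" by simp
  have "lo \<le> N div R" using zdiv_mono1[OF assms(4) R] R by simp
  moreover have "N div R * R \<le> N"
    using pos_mod_sign[OF R, of N] by (simp flip: minus_mod_eq_div_mult)
  then have "N div R * R \<le> hi * R" using assms(5) by (simp add: mult.commute)
  then have "N div R \<le> hi" using R by simp
  moreover have "N mod R = 0 \<or> N div R + 1 \<le> hi"
  proof (rule disjCI)
    assume "\<not> N div R + 1 \<le> hi"
    with \<open>N div R \<le> hi\<close> have "N div R = hi" by simp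
    then show "N mod R = 0" using N assms(5) pos_mod_sign[OF R, of N] by (simp add: mult.commute)
  qed
  ultimately show ?thesis using that[of "N mod R" "N div R"] R by (simp add: order_less_imp_le)
qed

lemma insert_horizontals:
  fixes R N e :: int
  assumes "passes w lo hi" "0 \<le> R" "lo \<le> 0" "0 \<le> hi" "R * lo \<le> N" "N \<le> R * hi" "\<bar>e\<bar> = 1"
  obtains w' where "even (tcount w') = even (tcount w)" "disp w' = disp w + e * R" "height w' = height w"
    "area2 w' = area2 w + 2 * e * N" "int (acount w') = int (acount w) + R"
    "tcount w' \<le> tcount w + 4" "passes w' lo hi"
proof -
  obtain q r where qr: "0 \<le> r" "r \<le> R" "lo \<le> q" "q \<le> hi" "r = 0 \<or> q + 1 \<le> hi" "N = q * R + r"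
    by (rule balanced_sum[OF assms(2-6)])
  obtain w1 where w1: "even (tcount w1) = even (tcount w)" "disp w1 = disp w + e * (R - r)" "height w1 = height w"
    "area2 w1 = area2 w + 2 * (e * (R - r)) * q" "int (acount w1) = int (acount w) + \<bar>e * (R - r)\<bar>"
    "tcount w1 \<le> tcount w + 2" "passes w1 lo hi"
    using insert_horizontal[OF assms(1) qr(3,4), of "e * (R - r)"] by blast
  \<comment> \<open>For \<open>r = 0\<close> the height \<open>q + 1\<close> may exceed
    \<open>hi\<close>; the empty insertion is then made at \<open>q\<close>.\<close>
  define q' where "q' = (if r = 0 then q else q + 1)"
  have "lo \<le> q'" "q' \<le> hi" using qr by (auto simp: q'_def)
  then obtain w2 where w2: "even (tcount w2) = even (tcount w1)" "disp w2 = disp w1 + e * r" "height w2 = height w1"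
    "area2 w2 = area2 w1 + 2 * (e * r) * q'" "int (acount w2) = int (acount w1) + \<bar>e * r\<bar>"
    "tcount w2 \<le> tcount w1 + 2" "passes w2 lo hi"
    using insert_horizontal[OF w1(7), of q' "e * r"] by blast
  have "r * q' = r * (q + 1)" by (simp add: q'_def)
  then have "2 * (e * (R - r)) * q + 2 * (e * r) * q' = 2 * (e * (R - r)) * q + 2 * (e * r) * (q + 1)"
    by (simp add: mult.assoc)
  also have "\<dots> = 2 * e * N" by (simp add: qr(6) algebra_simps)
  finally have "area2 w2 = area2 w + 2 * e * N" using w1(4) w2(4) by linarith
  moreover have "e * (R - r) + e * r = e * R" by (simp add: algebra_simps)
  then have "disp w2 = disp w + e * R" using w1(2) w2(2) by linarith
  moreover have "\<bar>e * (R - r)\<bar> + \<bar>e * r\<bar> = R" using qr(1,2) by (simp add: abs_mult assms(7))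
  then have "int (acount w2) = int (acount w) + R" using w1(5) w2(5) by linarith
  moreover have "tcount w2 \<le> tcount w + 4" using w1(6) w2(6) by linarith
  ultimately show ?thesis using that[of w2] w1(1,3) w2(1,3,7) by simp
qed

lemma apow_add:
  assumes "0 \<le> x \<and> 0 \<le> y \<or> x \<le> 0 \<and> y \<le> 0"
  shows "apow (x + y) = apow x @ apow y"
proof (cases "0 \<le> x \<and> 0 \<le> y")
  case True
  then show ?thesis by (simp add: apow_def nat_add_distrib replicate_add)
next
  case False
  then have "x \<le> 0" "y \<le> 0" using assms by auto
  then have "nat \<bar>x + y\<bar> = nat \<bar>x\<bar> + nat \<bar>y\<bar>" by simp
  moreover have "x < 0 \<or> y < 0" using False \<open>x \<le> 0\<close> \<open>y \<le> 0\<close> by auto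
  ultimately show ?thesis using \<open>x \<le> 0\<close> \<open>y \<le> 0\<close>
    by (cases "x = 0"; cases "y = 0") (simp_all add: apow_def replicate_add)
qed

text \<open>The path first visits the extreme on the other side of 0 from \<open>y\<close>, then the
  opposite extreme, and then returns to \<open>y\<close>. A final \<open>t\<close> adjusts the
  parity.\<close>

lemma vertical_word:
  assumes "lo \<le> 0" "0 \<le> hi" "lo \<le> y" "y \<le> hi"
  obtains w where "even (tcount w) = e" "disp w = y" "height w = y" "area2 w = 0"
    "int (acount w) = 2 * (hi - lo) - \<bar>y\<bar>" "tcount w \<le> 2" "passes w lo hi"
proof -
  define p where "p = (if 0 \<le> y then lo else hi)"
  define q where "q = (if 0 \<le> y then hi else lo)"
  define w where "w = wt @ apow p @ apow (q - p) @ apow (y - q) @ (if e then wt else [])"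
  have "passes w lo hi"
    unfolding passes_def
  proof (intro allI impI)
    fix h assume h: "lo \<le> h \<and> h \<le> hi"
    have "apow (q - p) = apow (h - p) @ apow (q - h)"
      using apow_add[of "h - p" "q - h"] h by (auto simp: p_def q_def)
    then have "w = (wt @ apow p @ apow (h - p)) @ (apow (q - h) @ apow (y - q) @ (if e then wt else []))"
      by (simp add: w_def)
    moreover have "height (wt @ apow p @ apow (h - p)) = h" by (simp add: height_def)
    ultimately show "\<exists>u v. w = u @ v \<and> height u = h" by blast
  qed
  moreover have "int (acount w) = 2 * (hi - lo) - \<bar>y\<bar>" using assms by (simp add: w_def p_def q_def)
  moreover have "even (tcount w) = e" "disp w = y" "height w = y" "area2 w = 0" "tcount w \<le> 2"
    by (simp_all add: w_def height_def area2_def power2_eq_square)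
  ultimately show ?thesis using that[of w] by simp
qed

text \<open>A vertical path with at most 2 letters \<open>t\<close> covers the same range of
  heights. All steps to the right are inserted at two heights, and so are those to the left, at 4
  letters \<open>t\<close> each.\<close>

lemma few_turns_mod_centre:
  obtains w' where "same_moments 2 w w'" "acount w' \<le> acount w" "tcount w' \<le> 10"
proof -
  obtain R L lo hi :: int where *: "0 \<le> R" "0 \<le> L" "lo \<le> 0" "0 \<le> hi"
    "lo \<le> height w" "height w \<le> hi" "R - L = disp w - height w"
    "2 * (R * lo - L * hi) \<le> area2 w" "area2 w \<le> 2 * (R * hi - L * lo)"
    "R + L + 2 * (hi - lo) - \<bar>height w\<bar> \<le> int (acount w)" by (rule path_bounds)
  have "even (area2 w)"
    by (rule class_nf[of w]) (auto simp: area2_def alt_0 power2_eq_square split: if_splits)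
  then obtain A where A: "area2 w = 2 * A" by blast
  \<comment> \<open>\<open>N\<close> and \<open>N - A\<close> are the areas assigned to the steps to
    the right and to the left; the largest admissible \<open>N\<close> puts both into the attainable
    intervals.\<close>
  define N where "N = min (R * hi) (A + L * hi)"
  have "R * lo \<le> R * hi" "L * lo \<le> L * hi" using * by (auto intro!: mult_left_mono)
  then have N: "R * lo \<le> N" "N \<le> R * hi" "L * lo \<le> N - A" "N - A \<le> L * hi"
    using *(8,9) A by (auto simp: N_def)
  obtain w0 where w0: "even (tcount w0) = even (tcount w)" "disp w0 = height w" "height w0 = height w"
    "area2 w0 = 0" "int (acount w0) = 2 * (hi - lo) - \<bar>height w\<bar>" "tcount w0 \<le> 2" "passes w0 lo hi"
    using vertical_word[OF *(3-6)] by blast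
  obtain w1 where w1: "even (tcount w1) = even (tcount w0)" "disp w1 = disp w0 + 1 * R" "height w1 = height w0"
    "area2 w1 = area2 w0 + 2 * 1 * N" "int (acount w1) = int (acount w0) + R"
    "tcount w1 \<le> tcount w0 + 4" "passes w1 lo hi"
    using insert_horizontals[OF w0(7) *(1,3,4) N(1,2), of 1] by auto
  obtain w2 where w2: "even (tcount w2) = even (tcount w1)" "disp w2 = disp w1 + (-1) * L" "height w2 = height w1"
    "area2 w2 = area2 w1 + 2 * (-1) * (N - A)" "int (acount w2) = int (acount w1) + L"
    "tcount w2 \<le> tcount w1 + 4" "passes w2 lo hi"
    using insert_horizontals[OF w1(7) *(2,3,4) N(3,4), of "-1"] by auto
  show ?thesis
    using that[of w2] w0 w1 w2 * A by (simp add: same_moments_2_iff)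
qed

section \<open>Geodesics have few turns\<close>

lemma tpos_bound: "p \<in> set (tpos u w) \<Longrightarrow> \<bar>p\<bar> \<le> \<bar>u\<bar> + int (length w)"
  by (induction u w rule: tpos.induct) (fastforce split: if_splits)+

lemma alt_bound:
  assumes "\<forall>p\<in>set ps. \<bar>p\<bar> \<le> M"
  shows "\<bar>alt j ps\<bar> \<le> int (length ps) * M ^ j"
  using assms
proof (induction ps)
  case (Cons p ps)
  have "\<bar>p ^ j\<bar> \<le> M ^ j" unfolding power_abs using Cons.prems by (intro power_mono) simp_all
  then show ?case using Cons by (simp add: algebra_simps)
qed simp

lemma psum_bound: "\<bar>psum j w\<bar> \<le> int (tcount w) * int (length w) ^ j"
  using alt_bound[of "tpos 0 w" "int (length w)" j] tpos_bound[of _ 0 w] by simp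

text \<open>The mixed terms of the third power sum of a concatenation contain only displacements and
  lower power sums, so they cancel in the difference.\<close>

lemma psum3_append_diff:
  assumes "same_moments 2 u u'" "same_moments 2 v v'"
  shows "\<bar>psum 3 (u @ v) - psum 3 (u' @ v')\<bar> \<le> \<bar>psum 3 u - psum 3 u'\<bar> + \<bar>psum 3 v - psum 3 v'\<bar>"
proof -
  define s where "s = 1 - 2 * psum 0 u"
  have s: "s = 1 \<or> s = -1" by (simp add: s_def alt_0)
  have "psum 3 (u @ v) - psum 3 (u' @ v') = (psum 3 u - psum 3 u') + s * (psum 3 v - psum 3 v')"
    using assms unfolding same_moments_2 psum_append minus_one_tcount s_def
    by (simp add: algebra_simps)
  then show ?thesis using s by auto
qed

lemma split_tcount:
  assumes "n \<le> tcount w"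
  obtains u v where "w = u @ v" "tcount u = n"
proof -
  have "\<exists>u v. w = u @ v \<and> tcount u = n"
    using assms
  proof (induction w rule: rev_induct)
    case (snoc l w)
    show ?case
    proof (cases "n \<le> tcount w")
      case True
      then obtain u v where "w = u @ v" "tcount u = n" using snoc.IH by blast
      then show ?thesis by (intro exI[of _ u] exI[of _ "v @ [l]"]) simp
    next
      case False
      then have "tcount (w @ [l]) = n" using snoc.prems by (auto split: if_splits)
      then show ?thesis by (intro exI[of _ "w @ [l]"] exI[of _ "[]"]) simp
    qed
  qed simp
  then show ?thesis using that by blast
qed

text \<open>Only the blocks of length at most \<open>T\<close> are replaced; there are at most
  \<open>length w / T\<close> others.\<close>

lemma shorten_blocks:
  assumes "11 * m \<le> tcount w"
  obtains w' where "same_moments 2 w w'" "\<bar>psum 3 w - psum 3 w'\<bar> \<le> int m * (21 * int T ^ 3)"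
    "T * (length w' + m) \<le> T * length w + length w"
proof -
  have "\<exists>w'. same_moments 2 w w' \<and> \<bar>psum 3 w - psum 3 w'\<bar> \<le> int m * (21 * int T ^ 3)
    \<and> T * (length w' + m) \<le> T * length w + length w"
    using assms
  proof (induction m arbitrary: w)
    case 0
    then show ?case by (intro exI[of _ w]) (simp add: same_moments_2)
  next
    case (Suc m)
    \<comment> \<open>A block has one \<open>t\<close> more than the 10 that a replacement may need,
      so every replacement saves a letter.\<close>
    obtain u v where w: "w = u @ v" and u: "tcount u = 11"
      using split_tcount[of 11 w] Suc.prems by auto
    have "11 * m \<le> tcount v" using Suc.prems u by (simp add: w)
    from Suc.IH[OF this] obtain v' where v': "same_moments 2 v v'"
      "\<bar>psum 3 v - psum 3 v'\<bar> \<le> int m * (21 * int T ^ 3)"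
      "T * (length v' + m) \<le> T * length v + length v" by blast
    have "\<exists>u'. same_moments 2 u u' \<and> \<bar>psum 3 u - psum 3 u'\<bar> \<le> 21 * int T ^ 3
      \<and> T * (length u' + 1) \<le> T * length u + length u"
    proof (cases "length u \<le> T")
      case True
      obtain u' where u': "same_moments 2 u u'" "acount u' \<le> acount u" "tcount u' \<le> 10"
        by (rule few_turns_mod_centre)
      have len: "length u' + 1 \<le> length u" using u u' length_counts[of u] length_counts[of u'] by simp
      have "\<bar>psum 3 u\<bar> \<le> 11 * int T ^ 3"
      proof (rule order_trans[OF psum_bound])
        show "int (tcount u) * int (length u) ^ 3 \<le> 11 * int T ^ 3"
          unfolding u using True by (intro mult_mono power_mono) simp_all
      qed
      moreover have "\<bar>psum 3 u'\<bar> \<le> 10 * int T ^ 3"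
      proof (rule order_trans[OF psum_bound])
        show "int (tcount u') * int (length u') ^ 3 \<le> 10 * int T ^ 3"
          using True len u' by (intro mult_mono power_mono) simp_all
      qed
      moreover have "T * (length u' + 1) \<le> T * length u" using len by (rule mult_le_mono2)
      ultimately show ?thesis using u'(1) by (intro exI[of _ u']) linarith
    next
      \<comment> \<open>A long block is kept; its own length, which exceeds \<open>T\<close>, pays
        for the saving it fails to make.\<close>
      case False
      then show ?thesis by (intro exI[of _ u]) (simp add: same_moments_2)
    qed
    then obtain u' where u': "same_moments 2 u u'" "\<bar>psum 3 u - psum 3 u'\<bar> \<le> 21 * int T ^ 3"
      "T * (length u' + 1) \<le> T * length u + length u" by blast
    have "\<bar>psum 3 w - psum 3 (u' @ v')\<bar> \<le> int (Suc m) * (21 * int T ^ 3)"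
      using psum3_append_diff[OF u'(1) v'(1)] u'(2) v'(2) unfolding w by (simp add: algebra_simps)
    moreover have "T * (length (u' @ v') + Suc m) \<le> T * length w + length w"
      using u'(3) v'(3) by (simp add: w algebra_simps)
    ultimately show ?case using same_moments_append[OF u'(1) v'(1)] w by blast
  qed
  then show ?thesis using that by blast
qed

section \<open>Short words with prescribed third power sum\<close>

definition cube_word :: "int \<Rightarrow> int \<Rightarrow> int \<Rightarrow> gen word" where
  "cube_word x y z = concat (map (\<lambda>p. apow p @ wt @ apow (- p)) [0, x, x + y, y, x + z, z, y + z, x + y + z])"

text \<open>The positions are the vertices of a box with edges \<open>x\<close>, \<open>y\<close>,
  \<open>z\<close>, ordered so that the alternating signs are the parities of the vertices. The
  power sums are thus mixed third differences, which vanish on polynomials of degree at most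
  2.\<close>

lemma cube_word_moments:
  "same_moments 2 (cube_word x y z) []" "psum 3 (cube_word x y z) = - 6 * (x * y * z)"
  by (simp_all add: cube_word_def same_moments_2 algebra_simps power2_eq_square power3_eq_cube)

lemma length_cube_word:
  assumes "\<bar>x\<bar> \<le> r" "\<bar>y\<bar> \<le> r" "\<bar>z\<bar> \<le> r" "1 \<le> r"
  shows "int (length (cube_word x y z)) \<le> 32 * r"
proof -
  have "\<bar>x + y\<bar> \<le> 2 * r" "\<bar>- x - y\<bar> \<le> 2 * r" "\<bar>x + z\<bar> \<le> 2 * r" "\<bar>- x - z\<bar> \<le> 2 * r"
    "\<bar>y + z\<bar> \<le> 2 * r" "\<bar>- y - z\<bar> \<le> 2 * r" "\<bar>x + y + z\<bar> \<le> 3 * r" "\<bar>- x - y - z\<bar> \<le> 3 * r"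
    using assms by linarith+
  then show ?thesis using assms by (simp add: cube_word_def)
qed

text \<open>Writing N = q r^2 + q' r + q'' with digits of size at most r, three cube words with
  edges of size at most r suffice.\<close>

lemma central_word:
  fixes N r :: int
  assumes "\<bar>N\<bar> \<le> r ^ 3" "1 \<le> r"
  obtains w where "same_moments 2 w []" "psum 3 w = 6 * N" "int (length w) \<le> 96 * r"
proof -
  define q where "q = N div r\<^sup>2"
  define q' where "q' = N mod r\<^sup>2 div r"
  define q'' where "q'' = N mod r\<^sup>2 mod r"
  have r2: "0 < r\<^sup>2" using assms by simp
  have N: "N = q * r * r + q' * r * 1 + q'' * 1 * 1"
    using div_mult_mod_eq[of N "r\<^sup>2"] div_mult_mod_eq[of "N mod r\<^sup>2" r]
    by (simp add: q_def q'_def q''_def power2_eq_square mult.assoc)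
  have "(- r) * r\<^sup>2 \<le> N" "N \<le> r * r\<^sup>2"
    using assms(1) by (simp_all add: power2_eq_square power3_eq_cube abs_le_iff)
  then have "(- r) * r\<^sup>2 div r\<^sup>2 \<le> q" "q \<le> r * r\<^sup>2 div r\<^sup>2"
    unfolding q_def using r2 by (intro zdiv_mono1; simp)+
  moreover have "c * r\<^sup>2 div r\<^sup>2 = c" for c
    using r2 by (intro nonzero_mult_div_cancel_right) simp
  ultimately have "- r \<le> q" "q \<le> r" by metis+
  then have q: "\<bar>q\<bar> \<le> r" by simp
  have "N mod r\<^sup>2 \<le> r * r" using pos_mod_bound[OF r2, of N] by (simp add: power2_eq_square)
  then have "q' \<le> r" unfolding q'_def using zdiv_mono1[of "N mod r\<^sup>2" "r * r" r] assms by simp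
  moreover have "0 \<le> q'"
    unfolding q'_def using pos_mod_sign[OF r2, of N] assms by (simp add: pos_imp_zdiv_nonneg_iff)
  ultimately have q': "\<bar>q'\<bar> \<le> r" by simp
  have q'': "\<bar>q''\<bar> \<le> r" using assms by (simp add: q''_def order_less_imp_le)
  define w where "w = cube_word (- q) r r @ cube_word (- q') r 1 @ cube_word (- q'') 1 1"
  have "same_moments 2 w ([] @ [] @ [])"
    unfolding w_def by (intro same_moments_append cube_word_moments)
  moreover have add: "psum 3 (u @ v) = psum 3 u + psum 3 v" if "same_moments 2 u []" for u v
    using that unfolding psum_append same_moments_2 minus_one_tcount by simp
  have "psum 3 w = 6 * N"
    unfolding w_def add[OF cube_word_moments(1)] cube_word_moments(2) by (subst N) simp
  moreover have "int (length w) \<le> 96 * r"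
    using length_cube_word[of "- q" r r r] length_cube_word[of "- q'" r r 1] length_cube_word[of "- q''" r 1 1]
      q q' q'' assms by (simp add: w_def)
  ultimately show ?thesis using that[of w] by simp
qed

text \<open>Otherwise 2000 i^6 blocks are treated with \<open>T = i ^ 4\<close>. At most i^6 of the
  savings are lost to long blocks, so 1999 i^6 letters remain saved. The third power sum changes by
  at most 42000 i^18, which is at most 6 (20 i^6)^3, so the repair costs at most 96 * 20 i^6 = 1920
  i^6 letters.\<close>

lemma minimal_tcount:
  assumes min: "minimal w" and i: "1 \<le> i" and len: "length w \<le> i ^ 10"
  shows "tcount w < 22000 * i ^ 6"
proof (rule ccontr)
  assume "\<not> tcount w < 22000 * i ^ 6"
  then have "11 * (2000 * i ^ 6) \<le> tcount w" by simp
  from shorten_blocks[OF this, of "i ^ 4"] obtain w' where w': "same_moments 2 w w'"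
    "\<bar>psum 3 w - psum 3 w'\<bar> \<le> int (2000 * i ^ 6) * (21 * int (i ^ 4) ^ 3)"
    "i ^ 4 * (length w' + 2000 * i ^ 6) \<le> i ^ 4 * length w + length w" by blast
  have "length w \<le> i ^ 4 * i ^ 6" using len by (simp flip: power_add)
  with w'(3) have "i ^ 4 * (length w' + 2000 * i ^ 6) \<le> i ^ 4 * (length w + i ^ 6)"
    by (simp add: algebra_simps)
  then have shorter: "length w' + 1999 * i ^ 6 \<le> length w" using i by simp
  have "6 dvd psum 3 w - psum 3 w'" using w'(1) by (rule psum3_diff_dvd)
  then obtain M where M: "psum 3 w - psum 3 w' = 6 * M" by blast
  \<comment> \<open>The repair is appended on the right, where its third power sum counts with the
    sign given by the parity of the turns before it.\<close>
  define N where "N = (1 - 2 * psum 0 w) * M"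
  have sign: "(1 - 2 * psum 0 w) * (1 - 2 * psum 0 w) = 1" "\<bar>1 - 2 * psum 0 w\<bar> = 1"
    by (simp_all add: alt_0)
  have "6 * \<bar>M\<bar> \<le> 42000 * int i ^ 18"
    using w'(2) unfolding M by (simp add: abs_mult flip: power_mult power_add)
  then have "\<bar>M\<bar> \<le> 8000 * int i ^ 18" by simp
  also have "8000 * int i ^ 18 = (20 * int i ^ 6) ^ 3" by (simp add: power_mult_distrib flip: power_mult)
  finally have "\<bar>N\<bar> \<le> (20 * int i ^ 6) ^ 3" by (simp add: N_def abs_mult sign)
  moreover have "1 \<le> int i ^ 6" using i by simp
  then have "1 \<le> 20 * int i ^ 6" by linarith
  ultimately obtain z where z: "same_moments 2 z []" "psum 3 z = 6 * N" "int (length z) \<le> 96 * (20 * int i ^ 6)"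
    by (rule central_word)
  have "psum 3 (w' @ z) = psum 3 w' + (1 - 2 * psum 0 w) * (6 * N)"
    using z(1,2) w'(1) unfolding psum_append same_moments_2 minus_one_tcount by simp
  also have "(1 - 2 * psum 0 w) * (6 * N) = 6 * (((1 - 2 * psum 0 w) * (1 - 2 * psum 0 w)) * M)"
    by (simp only: N_def mult_ac)
  also have "\<dots> = 6 * M" by (simp only: sign mult_1)
  finally have "psum 3 (w' @ z) = psum 3 w" using M by simp
  moreover have "same_moments 2 (w @ []) (w' @ z)"
    using w'(1) z(1) by (intro same_moments_append) (simp_all add: same_moments_2)
  ultimately have "same_moments 3 w (w' @ z)" unfolding same_moments_3 by simp
  then have "length w \<le> length (w' @ z)" using min unfolding minimal_def by blast
  moreover have "length z \<le> 1920 * i ^ 6"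
  proof -
    have "int (length z) \<le> int (1920 * i ^ 6)" using z(3) by simp
    then show ?thesis by (simp only: of_nat_le_iff)
  qed
  moreover have "0 < i ^ 6" using i by simp
  ultimately show False using shorter by simp
qed

section \<open>Geodesics as lists of exponents\<close>

fun runs :: "int list \<Rightarrow> gen word" where
  "runs [] = []"
| "runs [e] = apow e"
| "runs (e # e' # es) = apow e @ wt @ runs (e' # es)"

text \<open>Both formal letters for \<open>t\<close> denote the same generator; one of them is
  chosen.\<close>

definition positive_t :: "gen word \<Rightarrow> gen word" where
  "positive_t w = map (\<lambda>(x, b). (x, b \<or> x = Gen_t)) w"

lemma eval_positive_t: "map eval_letter (positive_t w) = map eval_letter w"
  by (auto simp: positive_t_def eval_letter_def class_letter split: gen.split)

lemma minimal_suffix: "minimal (u @ v) \<Longrightarrow> minimal v"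
  unfolding minimal_def
proof (intro allI impI)
  fix v' assume *: "\<forall>w'. same_moments 3 (u @ v) w' \<longrightarrow> length (u @ v) \<le> length w'" "same_moments 3 v v'"
  have "same_moments 3 (u @ v) (u @ v')"
    using *(2) by (intro same_moments_append3) (simp_all add: same_moments_def)
  with *(1) show "length v \<le> length v'" by fastforce
qed

lemma minimal_no_cancel: "\<not> minimal ((x, b) # (x, \<not> b) # w)"
proof
  have "pres_eq rels ([(x, b), (x, \<not> b)] @ w) ([] @ w)"
    by (intro pres_append pres_cancel pres_refl)
  then have "same_moments 3 ((x, b) # (x, \<not> b) # w) w" by (simp add: pres_eq_iff_same_moments)
  moreover assume "minimal ((x, b) # (x, \<not> b) # w)"
  ultimately show False unfolding minimal_def by fastforce
qed

lemma length_runs: "e \<in> set es \<Longrightarrow> \<bar>e\<bar> \<le> int (length (runs es))"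
  by (induction es rule: runs.induct) auto

lemma apow_Cons:
  "0 \<le> e \<Longrightarrow> apow (e + 1) = (Gen_a, True) # apow e"
  "e \<le> 0 \<Longrightarrow> apow (e - 1) = (Gen_a, False) # apow e"
proof -
  show "0 \<le> e \<Longrightarrow> apow (e + 1) = (Gen_a, True) # apow e" by (simp add: apow_def nat_add_distrib)
  show "apow (e - 1) = (Gen_a, False) # apow e" if "e \<le> 0"
  proof -
    have "nat \<bar>e - 1\<bar> = Suc (nat \<bar>e\<bar>)" using that by simp
    moreover have "e = 0 \<or> \<not> 0 \<le> e" using that by auto
    ultimately show ?thesis using that by (auto simp: apow_def)
  qed
qed

lemma runs_apow: "apow e' = (Gen_a, b) # apow e \<Longrightarrow> runs (e' # es) = (Gen_a, b) # runs (e # es)"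
  by (cases es) simp_all

lemma runs_nonzero: "e \<noteq> 0 \<Longrightarrow> \<exists>w. runs (e # es) = (Gen_a, 0 \<le> e) # w"
  by (cases es; cases "nat \<bar>e\<bar>") (auto simp: apow_def)

text \<open>A minimal word has no neighbouring inverse letters, so between two letters
  \<open>t\<close> all letters \<open>a\<close> have the same sign and form a power.\<close>

lemma minimal_runs:
  assumes "minimal w"
  obtains e es where "positive_t w = runs (e # es)" "length es = tcount w"
proof -
  have "\<exists>e es. positive_t w = runs (e # es) \<and> length es = tcount w"
    using assms
  proof (induction w)
    case Nil
    show ?case by (intro exI[of _ 0] exI[of _ "[]"]) (simp add: positive_t_def apow_def)
  next
    case (Cons l w)
    have "minimal w" using minimal_suffix[of "[l]" w] Cons.prems by simp
    then obtain e es where IH: "positive_t w = runs (e # es)" "length es = tcount w"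
      using Cons.IH by blast
    obtain x b where l: "l = (x, b)" by (cases l)
    show ?case
    proof (cases x)
      case Gen_t
      have "positive_t (l # w) = runs (0 # e # es)"
        using IH(1) by (simp add: positive_t_def l Gen_t apow_def)
      then show ?thesis using IH(2) by (intro exI[of _ 0] exI[of _ "e # es"]) (simp add: l Gen_t)
    next
      case Gen_a
      have same: "(0 \<le> e) = b" if "e \<noteq> 0"
      proof (rule ccontr)
        assume "(0 \<le> e) \<noteq> b"
        then have "(0 \<le> e) = (\<not> b)" by blast
        with runs_nonzero[OF that, of es] obtain v where "positive_t w = (Gen_a, \<not> b) # v"
          unfolding IH(1) by auto
        then obtain w'' where "w = (Gen_a, \<not> b) # w''"
          by (cases w) (auto simp: positive_t_def)
        then show False using Cons.prems minimal_no_cancel[of Gen_a b w''] by (simp add: l Gen_a)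
      qed
      define e' where "e' = (if b then e + 1 else e - 1)"
      have "apow e' = (Gen_a, b) # apow e"
        using same apow_Cons[of e] by (cases "e = 0"; cases b) (auto simp: e'_def)
      from runs_apow[OF this] have "positive_t (l # w) = runs (e' # es)"
        using IH(1) by (simp add: positive_t_def l Gen_a)
      then show ?thesis using IH(2) by (intro exI[of _ e'] exI[of _ es]) (simp add: l Gen_a)
    qed
  qed
  then show ?thesis using that by blast
qed

section \<open>Counting\<close>

lemma sum_powers_le: "2 \<le> (c::nat) \<Longrightarrow> (\<Sum>j\<le>k. c ^ j) \<le> c ^ Suc k"
proof (induction k)
  case (Suc k)
  then have "(\<Sum>j\<le>Suc k. c ^ j) \<le> 2 * c ^ Suc k" by simp
  also have "\<dots> \<le> c * c ^ Suc k" using Suc.prems by (rule mult_le_mono1)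
  finally show ?case by simp
qed simp

lemma geodesic_growth_le:
  assumes i: "1 \<le> i" and n: "1 \<le> n" "n \<le> i ^ 10"
  shows "geodesic_growth grp gens n \<le> (2 * n + 1) ^ (22000 * i ^ 6 + 1)"
proof -
  define A where "A = {- int n..int n}"
  define E where "E = {es. set es \<subseteq> A \<and> length es \<le> 22000 * i ^ 6}"
  have fin: "finite E" unfolding E_def by (rule finite_lists_length_le) (simp add: A_def)
  have "{W. geodesic grp gens W \<and> length W \<le> n} \<subseteq> (\<lambda>es. map eval_letter (runs es)) ` E"
  proof
    fix W assume "W \<in> {W. geodesic grp gens W \<and> length W \<le> n}"
    then obtain w where w: "minimal w" "length w \<le> n" and W: "W = map eval_letter w"
      unfolding geodesics_eq by blast
    obtain e es where es: "positive_t w = runs (e # es)" "length es = tcount w"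
      using w(1) by (rule minimal_runs)
    have "length (runs (e # es)) = length w" by (simp flip: es(1)) (simp add: positive_t_def)
    then have "\<bar>e'\<bar> \<le> int n" if "e' \<in> set (e # es)" for e'
      using length_runs[OF that] w(2) by linarith
    then have "set (e # es) \<subseteq> A" unfolding A_def by (fastforce simp: abs_le_iff)
    moreover have "tcount w < 22000 * i ^ 6" using minimal_tcount[OF w(1) i] w(2) n by simp
    \<comment> \<open>There is one exponent more than there are letters \<open>t\<close>; the strict
      bound on \<open>tcount w\<close> leaves room for it.\<close>
    ultimately have "e # es \<in> E" using es(2) by (simp add: E_def)
    moreover have "W = map eval_letter (runs (e # es))"
      unfolding W by (simp only: eval_positive_t flip: es(1))
    ultimately show "W \<in> (\<lambda>es. map eval_letter (runs es)) ` E" by blast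
  qed
  then have "geodesic_growth grp gens n \<le> card E"
    unfolding geodesic_growth_def using fin by (rule surj_card_le[rotated])
  also have "card A = 2 * n + 1" by (simp add: A_def)
  then have "card E = (\<Sum>j\<le>22000 * i ^ 6. (2 * n + 1) ^ j)"
    unfolding E_def by (subst card_lists_length_le) (simp_all add: A_def)
  also have "\<dots> \<le> (2 * n + 1) ^ Suc (22000 * i ^ 6)" using n by (intro sum_powers_le) simp
  finally show ?thesis by simp
qed

text \<open>The rounded-up tenth root is at most twice the true one, which gives 1024 = 2^10 and 64
  = 2^6.\<close>

lemma tenth_root:
  assumes "1 \<le> n"
  obtains i :: nat where "1 \<le> i" "n \<le> i ^ 10" "i ^ 10 \<le> 1024 * n"
    "real n powr (1/10) \<le> real i" "real i ^ 6 \<le> 64 * real n powr (3/5)"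
proof -
  define x where "x = real n powr (1/10)"
  define i where "i = nat \<lceil>x\<rceil>"
  have x: "1 \<le> x" unfolding x_def using assms by (intro ge_one_powr_ge_zero) simp_all
  have x10: "x ^ 10 = real n" and x6: "x ^ 6 = real n powr (3/5)"
    using assms by (simp_all add: x_def powr_power)
  have xi: "x \<le> real i" unfolding i_def by linarith
  have "real i \<le> 2 * x" using x unfolding i_def by linarith
  then have *: "real i ^ k \<le> 2 ^ k * x ^ k" for k
    using power_mono[of "real i" "2 * x" k] by (simp add: power_mult_distrib)
  have "real n \<le> real i ^ 10" unfolding x10[symmetric] using x xi by (intro power_mono) simp_all
  then have "n \<le> i ^ 10" by (simp only: of_nat_le_iff flip: of_nat_power)
  moreover have "real (i ^ 10) \<le> real (1024 * n)" using *[of 10] by (simp add: x10)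
  then have "i ^ 10 \<le> 1024 * n" by (simp only: of_nat_le_iff)
  moreover have "real i ^ 6 \<le> 64 * real n powr (3/5)" using *[of 6] by (simp add: x6)
  moreover have "1 \<le> i" using x xi by linarith
  ultimately show ?thesis using that xi by (simp add: x_def)
qed

lemma geodesic_growth_mono: "m \<le> n \<Longrightarrow> geodesic_growth grp gens m \<le> geodesic_growth grp gens n"
  unfolding geodesic_growth_def by (intro card_mono finite_geodesics) auto

theorem theorem4:
  shows "(\<lambda>n. real (geodesic_growth grp {elt_a, inv\<^bsub>grp\<^esub> elt_a, elt_t} n))
           \<asymp>\<^sub>g (\<lambda>n. exp (real n powr (3 / 5) * ln (real n)))"
  unfolding growth_equiv_def
proof
  \<comment> \<open>The exponent 22000 i^6 + 1 is at most (22000 * 64 + 1) n^(3/5), and C^(3/5) =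
    1500000^(6/5) exceeds that factor.\<close>
  define C :: nat where "C = 1500000 ^ 2"
  have C: "0 < C" "3 \<le> C" by (simp_all add: C_def)
  have C35: "1500000 \<le> real C powr (3/5)"
  proof -
    have "(1500000::real) powr 1 \<le> 1500000 powr (6/5)" by (intro powr_mono) simp_all
    also have "\<dots> = (1500000 powr 2) powr (3/5)" by (simp only: powr_powr) simp
    also have "(1500000::real) powr 2 = real C" by (simp add: C_def)
    finally show ?thesis by simp
  qed
  have "real (geodesic_growth grp gens n)
      \<le> real C * exp (real (C * n) powr (3/5) * ln (real (C * n))) + real C" if n: "1 \<le> n" for n
  proof -
    obtain i where i: "1 \<le> i" "n \<le> i ^ 10" "real i ^ 6 \<le> 64 * real n powr (3/5)"
      using tenth_root[OF n] by blast
    have n35: "1 \<le> real n powr (3/5)" using n by (intro ge_one_powr_ge_zero) simp_all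
    have "real (22000 * i ^ 6 + 1) \<le> 1500000 * real n powr (3/5)" using i(3) n35 by simp
    also have "\<dots> \<le> real C powr (3/5) * real n powr (3/5)" using C35 by (intro mult_right_mono) simp_all
    also have "\<dots> = real (C * n) powr (3/5)" by (simp add: powr_mult)
    finally have expo: "real (22000 * i ^ 6 + 1) \<le> real (C * n) powr (3/5)" .
    have "2 * n + 1 \<le> C * n"
    proof -
      have "2 * n + 1 \<le> 3 * n" using n by simp
      also have "\<dots> \<le> C * n" using C(2) by (rule mult_le_mono1)
      finally show ?thesis .
    qed
    then have base: "real (2 * n + 1) \<le> real (C * n)" by (simp only: of_nat_le_iff)
    have "real (geodesic_growth grp gens n) \<le> real ((2 * n + 1) ^ (22000 * i ^ 6 + 1))"
      using geodesic_growth_le[OF i(1) n i(2)] by (simp only: of_nat_le_iff)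
    also have "\<dots> = exp (real (22000 * i ^ 6 + 1) * ln (real (2 * n + 1)))"
      unfolding of_nat_power by (subst exp_of_nat_mult) (simp add: exp_ln)
    also have "\<dots> \<le> exp (real (C * n) powr (3/5) * ln (real (C * n)))"
      unfolding exp_le_cancel_iff using expo base by (intro mult_mono) (simp_all add: ln_mono)
    also have "\<dots> \<le> real C * exp (real (C * n) powr (3/5) * ln (real (C * n))) + real C"
      using C by (simp add: add_increasing2)
    finally show ?thesis .
  qed
  then show "(\<lambda>n. real (geodesic_growth grp gens n)) \<preceq>\<^sub>g (\<lambda>n. exp (real n powr (3/5) * ln (real n)))"
    unfolding growth_le_def using C by blast
next
  \<comment> \<open>The factors come from 22 i^10, from i = 2 j, and from j^10 <= 1024 n.\<close>
  define C :: nat where "C = 22 * 1024 * 1024"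
  have C: "0 < C" by (simp add: C_def)
  have "exp (real n powr (3/5) * ln (real n)) \<le> real C * real (geodesic_growth grp gens (C * n)) + real C"
    if n: "1 \<le> n" for n
  proof -
    obtain j where j: "1 \<le> j" "j ^ 10 \<le> 1024 * n" "real n powr (1/10) \<le> real j"
      using tenth_root[OF n] by blast
    \<comment> \<open>Doubling multiplies the sixth power by 64, which outweighs the factor 10 lost
      when ln n is replaced by the logarithm of the tenth root.\<close>
    define i where "i = 2 * j"
    have "22 * i ^ 10 \<le> C * n" using j(2) by (simp add: i_def power_mult_distrib C_def)
    then have growth: "(i + 1) ^ (2 * i ^ 6) \<le> geodesic_growth grp gens (C * n)"
      using geodesic_growth_ge[of i] geodesic_growth_mono j(1) by (simp add: i_def) (meson order_trans)
    have "real n powr (3/5) = (real n powr (1/10)) ^ 6" using n by (simp add: powr_power)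
    also have "\<dots> \<le> real j ^ 6" using j(3) by (intro power_mono) simp_all
    finally have "real n powr (3/5) \<le> real j ^ 6" .
    moreover have "0 \<le> real j ^ 6" by simp
    ultimately have "10 * real n powr (3/5) \<le> 128 * real j ^ 6" by linarith
    then have expo: "10 * real n powr (3/5) \<le> real (2 * i ^ 6)"
      by (simp add: i_def power_mult_distrib)
    have "real n powr (1/10) \<le> real (i + 1)" using j(3) by (simp add: i_def)
    then have "ln (real n powr (1/10)) \<le> ln (real (i + 1))" using n by (intro ln_mono) simp_all
    then have base: "ln (real n) / 10 \<le> ln (real (i + 1))" using n by (simp add: ln_powr)
    have "real n powr (3/5) * ln (real n) = (10 * real n powr (3/5)) * (ln (real n) / 10)" by simp
    also have "\<dots> \<le> real (2 * i ^ 6) * ln (real (i + 1))"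
      using expo base n by (intro mult_mono) simp_all
    finally have "exp (real n powr (3/5) * ln (real n)) \<le> exp (real (2 * i ^ 6) * ln (real (i + 1)))"
      by simp
    also have "\<dots> = real ((i + 1) ^ (2 * i ^ 6))"
      unfolding of_nat_power by (subst exp_of_nat_mult) (simp add: exp_ln)
    also have "\<dots> \<le> real (geodesic_growth grp gens (C * n))" using growth by (simp only: of_nat_le_iff)
    also have "\<dots> \<le> real C * real (geodesic_growth grp gens (C * n)) + real C"
    proof -
      have "1 * real (geodesic_growth grp gens (C * n)) \<le> real C * real (geodesic_growth grp gens (C * n))"
        using C by (intro mult_right_mono) simp_all
      then show ?thesis by simp
    qed
    finally show ?thesis .
  qed
  then show "(\<lambda>n. exp (real n powr (3/5) * ln (real n))) \<preceq>\<^sub>g (\<lambda>n. real (geodesic_growth grp gens n))"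
    unfolding growth_le_def using C by blast
qed

end
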